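(* Let $(G,\tau)$ be an abelian topological group such that $\tau_{\mathcal K}$ is compatible with $\tau$, i.e. $(G,\tau_{\mathcal K})^\wedge=(G,\tau)^\wedge$. If $(G,\tau_{\mathcal K})$ is not locally compact, then $(G,\tau^+)\notin\mathcal B$.
   Context: All groups are abelian. $\mathbb T$ is the unit circle in $\mathbb C$ and $\mathbb T_+=\{e^{2\pi i t}: t\in[-1/4,1/4]\}$. For a topological group $(G,\tau)$, $G^\wedge=(G,\tau)^\wedge$ is the group of continuous homomorphisms $G\to\mathbb T$; $\sigma(G^\wedge,G)$ is the topology of pointwise convergence on $G^\wedge$; the Bohr topology $\tau^+$ is the weakest topology on $G$ making all elements of $G^\wedge$ continuous. $\mathcal K$ is the family of all $\sigma(G^\wedge,G)$-compact subsets of $G^\wedge$, and $\tau_{\mathcal K}$ is the topology on $G$ of uniform convergence on the members of $\mathcal K$; the sets $K^\triangleleft=\{x\in G:\chi(x)\in\mathbb T_+\ \forall\chi\in K\}$, $K\in\mathcal K$, form a basis of neighborhoods of zero. $\mathcal B$ is the class of all precompact Hausdorff abelian groups $(G,w)$ for which there exists a locally compact group topology $\mu$ on $G$ with $\mu^+=w$. *)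

theory Defs
  imports "HOL-Analysis.Analysis"
begin

text \<open>
  Several topologies on one group are compared, so the group structure comes from the type class
  \<open>ab_group_add\<close> while topologies are values of type \<open>'a topology\<close> whose underlying set is the
  whole type.
\<close>

definition group_topology :: "'a::ab_group_add topology \<Rightarrow> bool" where
  "group_topology T \<longleftrightarrow>
     topspace T = UNIV \<and>
     continuous_map (prod_topology T T) T (\<lambda>(x, y). x + y) \<and>
     continuous_map T T uminus"

definition dual_group :: "'a::ab_group_add topology \<Rightarrow> ('a \<Rightarrow> complex) set" where
  "dual_group T =
     {h. continuous_map T (top_of_set (sphere 0 1)) h \<and> (\<forall>x y. h (x + y) = h x * h y)}"

definition pointwise_topology :: "'a::ab_group_add topology \<Rightarrow> ('a \<Rightarrow> complex) topology" where
  "pointwise_topology T = subtopology (product_topology (\<lambda>_. euclidean) UNIV) (dual_group T)"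

definition bohr_topology :: "'a::ab_group_add topology \<Rightarrow> 'a topology" where
  "bohr_topology T = topology_generated_by {h -` V | h V. h \<in> dual_group T \<and> open V}"

definition K_family :: "'a::ab_group_add topology \<Rightarrow> ('a \<Rightarrow> complex) set set" where
  "K_family T = {K. compactin (pointwise_topology T) K}"

text \<open>
  The topology of uniform convergence on the members of \<open>K_family T\<close>. That the right-hand side
  really defines a topology is \<open>openin_tau_K\<close> below.
\<close>

definition tau_K :: "'a::ab_group_add topology \<Rightarrow> 'a topology" where
  "tau_K T = topology (\<lambda>U. \<forall>x\<in>U. \<exists>K\<in>K_family T. \<exists>e>0.
     {y. \<forall>h\<in>K. dist (h y) (h x) < e} \<subseteq> U)"

lemma openin_tau_K:
  "openin (tau_K T) U \<longleftrightarrow>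
     (\<forall>x\<in>U. \<exists>K\<in>K_family T. \<exists>e>0. {y. \<forall>h\<in>K. dist (h y) (h x) < e} \<subseteq> U)"
proof -
  let ?P = "\<lambda>U. \<forall>x\<in>U. \<exists>K\<in>K_family T. \<exists>e>0. {y. \<forall>h\<in>K. dist (h y) (h x) < e} \<subseteq> U"
  have "?P (U \<inter> V)" if U: "?P U" and V: "?P V" for U V
  proof
    fix x assume x: "x \<in> U \<inter> V"
    obtain K d where K: "K \<in> K_family T" "d > 0" "{y. \<forall>h\<in>K. dist (h y) (h x) < d} \<subseteq> U"
      using U x by blast
    obtain L e where L: "L \<in> K_family T" "e > 0" "{y. \<forall>h\<in>L. dist (h y) (h x) < e} \<subseteq> V"
      using V x by blast
    have "K \<union> L \<in> K_family T"
      using K(1) L(1) by (simp add: K_family_def compactin_Un)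
    moreover have "min d e > 0" using K(2) L(2) by simp
    moreover have "{y. \<forall>h\<in>K \<union> L. dist (h y) (h x) < min d e} \<subseteq> U \<inter> V"
      using K(3) L(3) by auto
    ultimately show "\<exists>K\<in>K_family T. \<exists>e>0. {y. \<forall>h\<in>K. dist (h y) (h x) < e} \<subseteq> U \<inter> V"
      by blast
  qed
  moreover have "?P (\<Union>\<U>)" if "\<forall>U\<in>\<U>. ?P U" for \<U>
    using that by (meson Union_iff Union_upper subset_trans)
  ultimately have "istopology ?P"
    unfolding istopology_def by blast
  then show ?thesis
    unfolding tau_K_def by (simp add: topology_inverse')
qed

text \<open>Precompact in the sense of topological groups, i.e. totally bounded.\<close>

definition precompact_group :: "'a::ab_group_add topology \<Rightarrow> bool" where
  "precompact_group T \<longleftrightarrow>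
     (\<forall>U. openin T U \<and> 0 \<in> U \<longrightarrow> (\<exists>F. finite F \<and> (\<Union>x\<in>F. (+) x ` U) = UNIV))"

definition class_B :: "'a::ab_group_add topology \<Rightarrow> bool" where
  "class_B w \<longleftrightarrow>
     group_topology w \<and> precompact_group w \<and> Hausdorff_space w \<and>
     (\<exists>\<mu>. group_topology \<mu> \<and> locally_compact_space \<mu> \<and> bohr_topology \<mu> = w)"

end

theory Submission
  imports Defs
begin

text \<open>
  If \<open>(G, \<tau>\<^sup>+) \<in> \<B>\<close> is witnessed by a locally compact \<open>\<mu>\<close>, then \<open>\<mu>\<close> and \<open>\<tau>\<close> have the same Bohr
  topology, hence the same dual and the same \<open>\<tau>\<^sub>\<K>\<close>; so it suffices that \<open>\<mu>\<^sub>\<K>\<close> is locally compact.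

  First, a pointwise compact set \<open>K\<close> of characters of \<open>(G, \<mu>)\<close> is equicontinuous, so \<open>\<mu>\<^sub>\<K>\<close> is coarser
  than \<open>\<mu>\<close>. Otherwise there are compact neighbourhoods \<open>U\<^sub>n\<close> of \<open>0\<close> with \<open>U\<^sub>n\<^sub>+\<^sub>1 \<plusminus> U\<^sub>n\<^sub>+\<^sub>1 \<subseteq> U\<^sub>n\<close> and
  \<open>x\<^sub>n \<in> U\<^sub>n\<close>, \<open>\<chi>\<^sub>n \<in> K\<close> with \<open>\<chi>\<^sub>n(x\<^sub>n)\<close> far from \<open>1\<close>, all \<open>\<chi>\<^sub>n\<close> being trivial on the compact subgroup
  \<open>N = \<Inter>U\<^sub>n\<close>. A subsequence converges on the monoid generated by the \<open>x\<^sub>n\<close>, hence, by compactness of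
  \<open>K\<close>, pointwise on its closure modulo \<open>N\<close>, which is a Baire space; this gives uniform smallness
  near \<open>0\<close>, a contradiction.

  Second, some \<open>\<mu>\<^sub>\<K>\<close>-ball lies in a \<open>\<mu>\<close>-compact set. Arguments of finitely many characters map a compact
  neighbourhood of \<open>0\<close> onto a compact local subgroup of some \<open>\<real>\<^sup>m\<close>, which near \<open>0\<close> is a linear space \<open>L\<close>.
  Modulo a compact subgroup, \<open>L\<close> exponentiates onto an open subgroup of \<open>G\<close> with some kernel \<open>\<Lambda>\<close>; linear forms
  vanishing on \<open>\<Lambda>\<close> induce characters there, which extend to \<open>G\<close> because the circle is divisible. They
  confine the ball to the image of \<open>span \<Lambda>\<close> plus a bounded set, that is, of \<open>\<Lambda>\<close> plus a bounded set.
\<close>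

section \<open>Characters and their extension\<close>

text \<open>Purely algebraic: the extension argument produces homomorphisms whose continuity is only
  established afterwards.\<close>

definition circle_hom :: "('a::ab_group_add \<Rightarrow> complex) \<Rightarrow> bool" where
  "circle_hom h \<longleftrightarrow> (\<forall>x. norm (h x) = 1) \<and> (\<forall>x y. h (x + y) = h x * h y)"

primrec ntimes :: "nat \<Rightarrow> 'a::ab_group_add \<Rightarrow> 'a" where
  "ntimes 0 x = 0"
| "ntimes (Suc n) x = x + ntimes n x"

lemma ntimes_add: "ntimes (m + n) x = ntimes m x + ntimes n x"
  by (induction m) (auto simp: algebra_simps)

lemma ntimes_plus: "ntimes n (x + y) = ntimes n x + ntimes n y"
  by (induction n) (auto simp: algebra_simps)

lemma ntimes_diff: "ntimes n (x - y) = ntimes n x - ntimes n y"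
  by (induction n) (auto simp: algebra_simps)

lemma ntimes_mult: "ntimes (m * n) x = ntimes m (ntimes n x)"
  by (induction m) (auto simp: ntimes_add)

lemma circle_hom_ne0: "circle_hom h \<Longrightarrow> h x \<noteq> 0"
  by (metis circle_hom_def norm_zero zero_neq_one)

lemma circle_hom_zero: "circle_hom h \<Longrightarrow> h 0 = 1"
  by (metis add_0 circle_hom_def circle_hom_ne0 mult_cancel_right1)

lemma circle_hom_diff:
  assumes "circle_hom h" shows "h (x - y) = h x / h y"
proof -
  have "h x = h (x - y) * h y" using assms by (metis circle_hom_def diff_add_cancel)
  then show ?thesis using circle_hom_ne0[OF assms, of y] by simp
qed

lemma circle_hom_ntimes: "circle_hom h \<Longrightarrow> h (ntimes n x) = h x ^ n"
  by (induction n) (auto simp: circle_hom_zero circle_hom_def)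

lemma circle_hom_dist:
  assumes "circle_hom h" shows "dist (h x) (h y) = dist (h (x - y)) 1"
proof -
  have "h x = h (x - y) * h y" using assms by (metis circle_hom_def diff_add_cancel)
  then have "h x - h y = (h (x - y) - 1) * h y" by (simp add: algebra_simps)
  then show ?thesis using assms by (simp add: dist_norm norm_mult circle_hom_def)
qed

lemma circle_hom_power:
  assumes "circle_hom h" shows "circle_hom (\<lambda>x. h x ^ n)"
  using assms by (simp add: circle_hom_def norm_power power_mult_distrib)

text \<open>Squaring multiplies the distance to 1 by \<open>norm (w + 1)\<close>, which is at least
  3/2 while that distance is at most 1/2, so the powers \<open>z ^ (2 ^ k)\<close> must escape.
  Hence a character within 1/2 of 1 on a subgroup is trivial there.\<close>

lemma circle_power_away:
  fixes z :: complex
  assumes "z \<noteq> 1"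
  shows "\<exists>n. dist (z ^ n) 1 > 1/2"
proof (rule ccontr)
  assume "\<nexists>n. dist (z ^ n) 1 > 1/2"
  then have small: "norm (z ^ n - 1) \<le> 1/2" for n
    by (simp add: dist_norm not_less)
  have step: "norm (w ^ 2 - 1) \<ge> norm (w - 1) * (3/2)" if "norm (w - 1) \<le> 1/2" for w :: complex
  proof -
    have "w ^ 2 - 1 = (w - 1) * (w + 1)" by (simp add: algebra_simps power2_eq_square)
    moreover have "norm (w + 1) \<ge> 3/2"
      using that norm_triangle_ineq4[of "w + 1" "w - 1"] by simp
    ultimately show ?thesis by (metis norm_mult mult_left_mono norm_ge_zero)
  qed
  have "norm (z ^ (2 ^ k) - 1) \<ge> (3/2) ^ k * norm (z - 1)" for k
  proof (induction k)
    case (Suc k)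
    have "(3/2) ^ Suc k * norm (z - 1) = (3/2) ^ k * norm (z - 1) * (3/2)" by simp
    also have "\<dots> \<le> norm (z ^ (2 ^ k) - 1) * (3/2)" using Suc by (rule mult_right_mono) simp
    also have "\<dots> \<le> norm ((z ^ (2 ^ k)) ^ 2 - 1)" using small by (rule step)
    also have "(z ^ (2 ^ k)) ^ 2 = z ^ (2 ^ Suc k)" by (simp only: power_mult[symmetric] power_Suc mult.commute)
    finally show ?case .
  qed simp
  then have "(3/2) ^ k * norm (z - 1) \<le> 1/2" for k
    using small order_trans by blast
  moreover obtain k where "(1/2) / norm (z - 1) < (3/2) ^ k"
    using real_arch_pow[of "3/2" "(1/2) / norm (z - 1)"] by auto
  ultimately show False
    using assms by (simp add: field_simps not_less[symmetric])
qed

text \<open>A partial character as a subgroup of the product; single-valuedness is stated over 0 and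
  spreads by subtraction. As relations, partial characters can be united along chains.\<close>

definition char_graph :: "('a::ab_group_add \<times> complex) set \<Rightarrow> bool" where
  "char_graph R \<longleftrightarrow> (0, 1) \<in> R
     \<and> (\<forall>x a y b. (x, a) \<in> R \<longrightarrow> (y, b) \<in> R \<longrightarrow> (x - y, a / b) \<in> R)
     \<and> (\<forall>a. (0, a) \<in> R \<longrightarrow> a = 1) \<and> (\<forall>x a. (x, a) \<in> R \<longrightarrow> norm a = 1)"

lemma char_graphD:
  assumes "char_graph R"
  shows "(0, 1) \<in> R" "(x, a) \<in> R \<Longrightarrow> (y, b) \<in> R \<Longrightarrow> (x - y, a / b) \<in> R"
    "(0, a) \<in> R \<Longrightarrow> a = 1" "(x, a) \<in> R \<Longrightarrow> norm a = 1"
  using assms unfolding char_graph_def by blast+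

lemma char_graph_minus:
  assumes "char_graph R" "(x, a) \<in> R" shows "(- x, 1 / a) \<in> R"
  using char_graphD(2)[OF assms(1) char_graphD(1)[OF assms(1)] assms(2)] by simp

lemma char_graph_plus:
  assumes "char_graph R" "(x, a) \<in> R" "(y, b) \<in> R" shows "(x + y, a * b) \<in> R"
  using char_graphD(2)[OF assms(1,2) char_graph_minus[OF assms(1,3)]] by simp

lemma char_graph_unique:
  assumes "char_graph R" "(x, a) \<in> R" "(x, b) \<in> R" shows "a = b"
proof -
  have "a / b = 1"
    using char_graphD(2)[OF assms] char_graphD(3)[OF assms(1), of "a / b"] by (simp del: divide_eq_1_iff)
  moreover have "b \<noteq> 0" using char_graphD(4)[OF assms(1,3)] by auto
  ultimately show ?thesis by simp
qed

lemma char_graph_ntimes: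
  assumes "char_graph R" "(x, a) \<in> R" shows "(ntimes n x, a ^ n) \<in> R"
  by (induction n) (auto simp: assms char_graphD(1) char_graph_plus)

text \<open>\<open>w\<close> is the value to be prescribed at \<open>z\<close>. If no positive
  multiple of \<open>z\<close> lies in the domain, \<open>-1\<close> will do. Otherwise the least
  such \<open>n\<close> imposes \<open>w ^ n = c\<close>, and \<open>n \<ge> 2\<close> leaves two
  distinct roots, not both equal to 1.\<close>

lemma char_graph_root:
  assumes R: "char_graph R" and z: "z \<notin> Domain R"
  obtains w where "norm w = 1" "w \<noteq> 1" "\<And>n a. (ntimes n z, a) \<in> R \<Longrightarrow> w ^ n = a"
proof (cases "\<exists>n>0. ntimes n z \<in> Domain R")
  case False
  show ?thesis
  proof (rule that[of "-1"])
    show "(-1) ^ n = a" if "(ntimes n z, a) \<in> R" for n a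
    proof -
      have "n = 0" using False that by auto
      then show ?thesis using that char_graphD(3)[OF R] by simp
    qed
  qed auto
next
  case True
  define n where "n = (LEAST n. n > 0 \<and> ntimes n z \<in> Domain R)"
  have n: "n > 0" "ntimes n z \<in> Domain R"
    using LeastI_ex[OF True[unfolded Bex_def]] by (simp_all add: n_def)
  have least: "m = 0" if "m < n" "ntimes m z \<in> Domain R" for m
    using not_less_Least[of m "\<lambda>n. n > 0 \<and> ntimes n z \<in> Domain R"] that by (auto simp: n_def)
  obtain c where c: "(ntimes n z, c) \<in> R" using n by blast
  have norm_c: "norm c = 1" using char_graphD(4)[OF R c] .
  have "n \<noteq> 1" using n z by auto
  then have n2: "n \<ge> 2" using n by simp
  have root: "w ^ p = a" if w: "w ^ n = c" and p: "(ntimes p z, a) \<in> R" for w p a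
  proof -
    \<comment> \<open>Minimality of \<open>n\<close> kills the remainder \<open>r\<close>, so the
      single equation \<open>w ^ n = c\<close> settles every multiple of \<open>z\<close> in the
      domain.\<close>
    define q r where "q = p div n" and "r = p mod n"
    have p_eq: "p = q * n + r" by (simp add: q_def r_def)
    have q: "(ntimes (q * n) z, c ^ q) \<in> R"
      using char_graph_ntimes[OF R c] by (simp add: ntimes_mult)
    have "(ntimes p z - ntimes (q * n) z, a / c ^ q) \<in> R"
      by (rule char_graphD(2)[OF R p q])
    then have rR: "(ntimes r z, a / c ^ q) \<in> R" by (simp add: p_eq ntimes_add)
    have "r = 0" using least[of r] rR n(1) by (auto simp: r_def)
    then have "w ^ p = c ^ q" using w by (simp add: p_eq mult.commute power_mult)
    moreover have "a = c ^ q"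
      using char_graph_unique[OF R p] q \<open>r = 0\<close> by (simp add: p_eq)
    ultimately show ?thesis by simp
  qed
  define u where "u = cis (Arg c / n)"
  define v where "v = cis (2 * pi / n)"
  have u: "u ^ n = c"
  proof -
    have "c \<noteq> 0" using norm_c by auto
    then have "cis (Arg c) = c" using norm_c by (simp add: cis_Arg sgn_div_norm)
    moreover have "u ^ n = cis (n * (Arg c / n))" unfolding u_def by (rule Complex.DeMoivre)
    moreover have "n * (Arg c / n) = Arg c" using n(1) by simp
    ultimately show ?thesis by metis
  qed
  have v: "v ^ n = 1" using n(1) Complex.DeMoivre[of "2 * pi / n" n] by (simp add: v_def)
  have norm_uv: "norm u = 1" "norm (u * v) = 1" by (simp_all add: u_def v_def norm_mult)
  have "v \<noteq> 1"
  proof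
    assume "v = 1"
    then have "cos (2 * pi / n) = 1" by (metis v_def cis.sel(1) one_complex.sel(1))
    then obtain k :: int where "2 * pi / n = k * 2 * pi"
      by (auto simp: cos_one_2pi_int)
    then have "1 = real_of_int (k * int n)" using n by (simp add: field_simps)
    then have "k * int n = 1" by linarith
    then show False using n2 zmult_eq_1_iff[of k "int n"] by auto
  qed
  then have "u \<noteq> 1 \<or> u * v \<noteq> 1" by (auto)
  then show ?thesis
  proof
    assume "u \<noteq> 1"
    then show ?thesis using that[of u] root[OF u] norm_uv by blast
  next
    assume "u * v \<noteq> 1"
    moreover have "(u * v) ^ n = c" using u v by (simp add: power_mult_distrib)
    ultimately show ?thesis using that[of "u * v"] root norm_uv by blast
  qed
qed

lemma char_graph_extend_one:
  assumes R: "char_graph R" and z: "z \<notin> Domain R"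
  obtains R' w where "char_graph R'" "R \<subseteq> R'" "(z, w) \<in> R'" "w \<noteq> 1"
proof -
  obtain w where w: "norm w = 1" "w \<noteq> 1" and wR: "\<And>n a. (ntimes n z, a) \<in> R \<Longrightarrow> w ^ n = a"
    using char_graph_root[OF assms] by blast
  have w0: "w \<noteq> 0" using w(1) by auto
  \<comment> \<open>The subgroup generated by \<open>R\<close> and \<open>(z, w)\<close>; the pair
    \<open>n\<close>, \<open>m\<close> of naturals plays the role of one integer multiple.\<close>
  define R' where
    "R' = {(x + ntimes n z - ntimes m z, a * w ^ n / w ^ m) | x a n m. (x, a) \<in> R}"
  have intro: "(x + ntimes n z - ntimes m z, a * w ^ n / w ^ m) \<in> R'" if "(x, a) \<in> R" for x a n m
    using that unfolding R'_def by blast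
  have "char_graph R'"
    unfolding char_graph_def
  proof (intro conjI allI impI)
    show "(0, 1) \<in> R'" using intro[OF char_graphD(1)[OF R], of 0 0] by simp
  next
    fix x a y b assume "(x, a) \<in> R'" "(y, b) \<in> R'"
    then obtain x1 a1 n1 m1 x2 a2 n2 m2 where *: "(x1, a1) \<in> R" "(x2, a2) \<in> R"
      "x = x1 + ntimes n1 z - ntimes m1 z" "a = a1 * w ^ n1 / w ^ m1"
      "y = x2 + ntimes n2 z - ntimes m2 z" "b = a2 * w ^ n2 / w ^ m2"
      unfolding R'_def by blast
    have "(x1 - x2, a1 / a2) \<in> R" using char_graphD(2)[OF R *(1,2)] .
    from intro[OF this, of "n1 + m2" "m1 + n2"]
    show "(x - y, a / b) \<in> R'"
      using w0 by (simp add: * ntimes_add power_add algebra_simps)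
  next
    fix a assume "(0, a) \<in> R'"
    then obtain x c n m where *: "(x, c) \<in> R" "0 = x + ntimes n z - ntimes m z"
      "a = c * w ^ n / w ^ m" unfolding R'_def by blast
    have c0: "c \<noteq> 0" using char_graphD(4)[OF R *(1)] by auto
    show "a = 1"
    proof (cases "n \<ge> m")
      case True
      then obtain k where k: "n = m + k" using le_Suc_ex by blast
      have "ntimes k z = - x" using *(2) by (simp add: k ntimes_add algebra_simps eq_neg_iff_add_eq_0)
      then have "w ^ k = 1 / c" using wR char_graph_minus[OF R *(1)] by simp
      then show ?thesis using w0 c0 by (simp add: *(3) k power_add)
    next
      case False
      then obtain k where k: "m = n + k" using le_Suc_ex nat_le_linear by blast
      have "ntimes k z = x" using *(2) by (simp add: k ntimes_add algebra_simps)
      then have "w ^ k = c" using wR *(1) by simp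
      then show ?thesis using w0 c0 by (simp add: *(3) k power_add)
    qed
  next
    fix x a assume "(x, a) \<in> R'"
    then show "norm a = 1"
      unfolding R'_def using w(1) char_graphD(4)[OF R]
      by (auto simp: norm_mult norm_divide norm_power)
  qed
  moreover have "R \<subseteq> R'" using intro[of _ _ 0 0] by auto
  moreover have "(z, w) \<in> R'" using intro[OF char_graphD(1)[OF R], of 1 0] by simp
  ultimately show ?thesis using that w(2) by blast
qed

text \<open>The circle is divisible, hence injective: a Zorn argument over graphs of partial characters.\<close>

lemma char_graph_extend:
  assumes R: "char_graph R"
  obtains h where "circle_hom h" "\<And>x a. (x, a) \<in> R \<Longrightarrow> h x = a"
proof -
  define A where "A = {R'. char_graph R' \<and> R \<subseteq> R'}"
  have "\<exists>M\<in>A. \<forall>X\<in>A. M \<subseteq> X \<longrightarrow> X = M"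
  proof (rule subset_Zorn_nonempty)
    show "A \<noteq> {}" using R by (auto simp: A_def)
    fix C assume C: "C \<noteq> {}" "subset.chain A C"
    then have CA: "X \<in> C \<Longrightarrow> char_graph X \<and> R \<subseteq> X" for X
      by (auto simp: A_def subset.chain_def)
    have "(x - y, a / b) \<in> \<Union>C" if "(x, a) \<in> \<Union>C" "(y, b) \<in> \<Union>C" for x a y b
    proof -
      obtain X Y where XY: "X \<in> C" "Y \<in> C" "(x, a) \<in> X" "(y, b) \<in> Y" using \<open>(x, a) \<in> \<Union>C\<close> \<open>(y, b) \<in> \<Union>C\<close> by blast
      then have "X \<subseteq> Y \<or> Y \<subseteq> X" using C(2) unfolding subset.chain_def by auto
      then show ?thesis
      proof
        assume "X \<subseteq> Y"
        then show ?thesis using XY CA char_graphD(2) by (metis UnionI subsetD)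
      next
        assume "Y \<subseteq> X"
        then show ?thesis using XY CA char_graphD(2) by (metis UnionI subsetD)
      qed
    qed
    moreover have "(0, 1) \<in> \<Union>C" "R \<subseteq> \<Union>C" using C(1) CA char_graphD(1) by blast+
    moreover have "a = 1" if "(0, a) \<in> \<Union>C" for a using that CA char_graphD(3) by blast
    moreover have "norm a = 1" if "(x, a) \<in> \<Union>C" for x a using that CA char_graphD(4) by blast
    ultimately show "\<Union>C \<in> A" unfolding A_def char_graph_def by blast
  qed
  then obtain M where M: "char_graph M" "R \<subseteq> M"
    and max: "\<And>X. char_graph X \<Longrightarrow> M \<subseteq> X \<Longrightarrow> X = M"
    unfolding A_def by (smt (verit, best) mem_Collect_eq order_trans)
  have total: "x \<in> Domain M" for x
  proof (rule ccontr)
    assume "x \<notin> Domain M"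
    then obtain R' w where "char_graph R'" "M \<subseteq> R'" "(x, w) \<in> R'"
      using char_graph_extend_one[OF M(1)] by metis
    then show False using max \<open>x \<notin> Domain M\<close> by blast
  qed
  define h where "h x = (SOME a. (x, a) \<in> M)" for x
  have hM: "(x, h x) \<in> M" for x using total[of x] unfolding h_def by (meson DomainE someI)
  have h_eq: "h x = a" if "(x, a) \<in> M" for x a
    using char_graph_unique[OF M(1) hM that] .
  have "circle_hom h" unfolding circle_hom_def
    using char_graphD(4)[OF M(1) hM] h_eq[OF char_graph_plus[OF M(1) hM hM]] by blast
  then show ?thesis using that[of h] h_eq M(2) by blast
qed

text \<open>Applied to the trivial character of a subgroup, this separates the subgroup from a point
  outside it.\<close>

lemma char_graph_extend_separating:
  assumes "char_graph R" "z \<notin> Domain R"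
  obtains h where "circle_hom h" "\<And>x a. (x, a) \<in> R \<Longrightarrow> h x = a" "h z \<noteq> 1"
proof -
  obtain R' w where R': "char_graph R'" "R \<subseteq> R'" "(z, w) \<in> R'" "w \<noteq> 1"
    using char_graph_extend_one[OF assms] by blast
  obtain h where "circle_hom h" "\<And>x a. (x, a) \<in> R' \<Longrightarrow> h x = a"
    using char_graph_extend[OF R'(1)] by blast
  then show ?thesis using that[of h] R' by blast
qed

section \<open>Compact local subgroups of normed spaces\<close>

text \<open>A compact local subgroup of a normed space is linear near the origin: the directions in which
  it contains a segment form a subspace, and elements off that subspace tending to \<open>0\<close> would have
  multiples accumulating at a further such direction.\<close>

lemma local_subgroup_linear:
  fixes S :: "'v::real_normed_vector set"
  assumes S: "compact S" "0 \<in> S" "\<And>s. s \<in> S \<Longrightarrow> - s \<in> S"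
    and a: "a > 0" and Sa: "S \<subseteq> cball 0 a"
    and add: "\<And>s t. s \<in> S \<Longrightarrow> t \<in> S \<Longrightarrow> norm (s + t) \<le> a \<Longrightarrow> s + t \<in> S"
  obtains L b where "subspace L" "0 < b" "b \<le> a" "S \<inter> cball 0 b = L \<inter> cball 0 b"
proof -
  have mult: "real n *\<^sub>R s \<in> S" if "s \<in> S" "norm (real n *\<^sub>R s) \<le> a" for n s
    using that(2)
  proof (induction n)
    case (Suc n)
    have "norm (real n *\<^sub>R s) \<le> norm (real (Suc n) *\<^sub>R s)" by (simp add: mult_right_mono)
    then have "real n *\<^sub>R s \<in> S" using Suc by simp
    then show ?case using add[OF that(1), of "real n *\<^sub>R s"] Suc.prems by (simp add: algebra_simps)
  qed (simp add: S)
  define L where "L = {s. \<exists>d>0. \<forall>t. \<bar>t\<bar> \<le> d \<longrightarrow> t *\<^sub>R s \<in> S}"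
  have L_S: "s \<in> S" if s: "s \<in> L" "norm s \<le> a" for s
  proof -
    obtain d where d: "d > 0" "\<And>t. \<bar>t\<bar> \<le> d \<Longrightarrow> t *\<^sub>R s \<in> S" using s by (auto simp: L_def)
    obtain n where n: "n > 0" "inverse (real n) < d" using ex_inverse_of_nat_less[OF d(1)] by auto
    have "(1 / real n) *\<^sub>R s \<in> S" using d(2) n by (simp add: field_simps)
    from mult[OF this, of n] show ?thesis using n s by simp
  qed
  have L_scale: "c *\<^sub>R s \<in> L" if s: "s \<in> L" for c s
  proof (cases "c = 0")
    case True
    then show ?thesis using S by (auto simp: L_def intro: exI[of _ 1])
  next
    case False
    obtain d where d: "d > 0" "\<And>t. \<bar>t\<bar> \<le> d \<Longrightarrow> t *\<^sub>R s \<in> S" using s by (auto simp: L_def)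
    show ?thesis unfolding L_def
      using False d by (auto intro!: exI[of _ "d / \<bar>c\<bar>"] d(2) simp: field_simps abs_mult)
  qed
  have L_add: "s + s' \<in> L" if s: "s \<in> L" and s': "s' \<in> L" for s s'
  proof -
    obtain d where d: "d > 0" "\<And>t. \<bar>t\<bar> \<le> d \<Longrightarrow> t *\<^sub>R s \<in> S" using s by (auto simp: L_def)
    obtain d' where d': "d' > 0" "\<And>t. \<bar>t\<bar> \<le> d' \<Longrightarrow> t *\<^sub>R s' \<in> S" using s' by (auto simp: L_def)
    define e where "e = min (min d d') (a / (norm (s + s') + 1))"
    have n1: "norm (s + s') + 1 > 0" by (meson add_nonneg_pos norm_ge_zero zero_less_one)
    have "t *\<^sub>R (s + s') \<in> S" if "\<bar>t\<bar> \<le> e" for t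
    proof -
      have "\<bar>t\<bar> * norm (s + s') \<le> \<bar>t\<bar> * (norm (s + s') + 1)" by (simp add: mult_left_mono)
      also have "\<dots> \<le> a" using that n1 by (simp add: e_def field_simps)
      finally have "norm (t *\<^sub>R s + t *\<^sub>R s') \<le> a" by (metis norm_scaleR scaleR_right_distrib)
      then show ?thesis using add d(2) d'(2) that by (simp add: scaleR_right_distrib e_def)
    qed
    moreover have "e > 0" using d d' a n1 by (simp add: e_def)
    ultimately show ?thesis unfolding L_def by blast
  qed
  have L_0: "0 \<in> L" using S by (auto simp: L_def intro: exI[of _ 1])
  have L: "subspace L" using L_0 L_add L_scale by (simp add: subspace_def)
  have Lc: "L \<inter> cball 0 a \<subseteq> S" using L_S by auto
  \<comment> \<open>Closedness makes this part of \<open>L\<close> compact, so that nearest points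
    in it exist.\<close>
  have "closed (L \<inter> cball 0 a)"
    unfolding closed_sequential_limits
  proof (intro allI impI, elim conjE)
    fix x l assume x: "\<forall>n. x n \<in> L \<inter> cball 0 a" and lim: "x \<longlonglongrightarrow> l"
    have "t *\<^sub>R l \<in> S" if "\<bar>t\<bar> \<le> 1" for t
    proof (rule closed_sequentially[OF compact_imp_closed[OF S(1)]])
      show "t *\<^sub>R x n \<in> S" for n
      proof (rule L_S)
        show "t *\<^sub>R x n \<in> L" using x L_scale by blast
        have "\<bar>t\<bar> * norm (x n) \<le> 1 * a" using x that by (intro mult_mono) auto
        then show "norm (t *\<^sub>R x n) \<le> a" by simp
      qed
      show "(\<lambda>n. t *\<^sub>R x n) \<longlonglongrightarrow> t *\<^sub>R l" using lim by (intro tendsto_intros)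
    qed
    then have "l \<in> L" "l \<in> S" unfolding L_def by (auto intro: exI[of _ 1] dest: spec[of _ 1])
       (metis abs_one order_refl scaleR_one)
    then show "l \<in> L \<inter> cball 0 a" using Sa by blast
  qed
  then have Lcomp: "compact (L \<inter> cball 0 a)"
    using compact_Int_closed[OF S(1)] Lc by (metis inf.absorb_iff2)
  have "\<exists>b. 0 < b \<and> b \<le> a \<and> S \<inter> cball 0 b \<subseteq> L"
  proof (rule ccontr)
    assume neg: "\<nexists>b. 0 < b \<and> b \<le> a \<and> S \<inter> cball 0 b \<subseteq> L"
    \<comment> \<open>The witness is \<open>s - l\<close>, with \<open>l\<close> nearest to
      \<open>s \<notin> L\<close> in \<open>L \<inter> cball 0 a\<close>. Its nearest point in all
      of \<open>L\<close> is then 0, because competitors outside the ball are too far away when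
      \<open>b \<le> a / 2\<close>.\<close>
    have ex: "\<exists>u\<in>S. u \<noteq> 0 \<and> norm u \<le> b \<and> (\<forall>l\<in>L. norm (u - l) \<ge> norm u)"
      if b: "0 < b" "b \<le> a / 2" for b
    proof -
      obtain s where s: "s \<in> S" "norm s \<le> b" "s \<notin> L"
      proof -
        have "b \<le> a" using b by simp
        then have "\<not> S \<inter> cball 0 b \<subseteq> L" using neg b by blast
        then show ?thesis using that by (auto simp: subset_iff)
      qed
      obtain l where l: "l \<in> L" "norm l \<le> a" "\<And>l'. l' \<in> L \<Longrightarrow> norm l' \<le> a \<Longrightarrow> norm (s - l) \<le> norm (s - l')"
      proof -
        have "\<exists>l\<in>L \<inter> cball 0 a. \<forall>l'\<in>L \<inter> cball 0 a. norm (s - l) \<le> norm (s - l')"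
          using L_0 a by (intro continuous_attains_inf[OF Lcomp] continuous_intros) auto
        then show ?thesis using that by auto
      qed
      have us: "norm (s - l) \<le> norm s" using l(3)[OF L_0] a by simp
      have "s - l \<in> S" using add[OF s(1) S(3)[OF L_S[OF l(1,2)]]] us s(2) b by simp
      moreover have "s - l \<noteq> 0" using s l by auto
      moreover have "norm (s - l - l') \<ge> norm (s - l)" if "l' \<in> L" for l'
      proof (cases "norm (l + l') \<le> a")
        case True
        then show ?thesis using l(3)[of "l + l'"] L_add[OF l(1) that] by (simp add: algebra_simps)
      next
        case False
        then have "norm (s - (l + l')) \<ge> a - norm s"
          using norm_triangle_ineq2[of "l + l'" s] by (simp add: norm_minus_commute)
        then show ?thesis using us s(2) b by (simp add: algebra_simps)
      qed
      ultimately show ?thesis using us s by (intro bexI[of _ "s - l"]) auto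
    qed
    have "\<exists>u. \<forall>n. u n \<in> S \<and> u n \<noteq> 0 \<and> norm (u n) \<le> a / 2 / real (Suc n) \<and> (\<forall>l\<in>L. norm (u n - l) \<ge> norm (u n))"
    proof (rule choice, rule allI)
      fix n
      have "a / 2 / real (Suc n) \<le> a / 2 / 1" using a by (intro divide_left_mono) auto
      then show "\<exists>u. u \<in> S \<and> u \<noteq> 0 \<and> norm u \<le> a / 2 / real (Suc n) \<and> (\<forall>l\<in>L. norm (u - l) \<ge> norm u)"
        using ex[of "a / 2 / real (Suc n)"] a by auto
    qed
    then obtain u where u: "\<And>n. u n \<in> S" "\<And>n. u n \<noteq> 0" "\<And>n. norm (u n) \<le> a / 2 / real (Suc n)"
      "\<And>n l. l \<in> L \<Longrightarrow> norm (u n - l) \<ge> norm (u n)" by blast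
    have "(\<lambda>n. a / 2 / real (Suc n)) \<longlonglongrightarrow> 0" by (rule LIMSEQ_Suc[OF lim_const_over_n])
    moreover have "\<forall>\<^sub>F n in sequentially. norm (u n) \<le> a / 2 / real (Suc n)" using u(3) by (intro always_eventually) blast
    ultimately have u0: "u \<longlonglongrightarrow> 0" by (rule Lim_null_comparison[rotated])
    have ua: "norm (u n) \<le> a / 2" for n
    proof -
      have "a / 2 / real (Suc n) \<le> a / 2 / 1" using a by (intro divide_left_mono) auto
      then have "a / 2 / real (Suc n) \<le> a / 2" by (simp only: div_by_1)
      then show ?thesis by (rule order_trans[OF u(3)])
    qed
    \<comment> \<open>The largest multiple of \<open>u n\<close> that stays in
      \<open>cball 0 a\<close>; its norm is at least \<open>a / 2\<close>.\<close>
    define k where "k n = nat \<lfloor>a / norm (u n)\<rfloor>" for n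
    have k_le: "real (k n) * norm (u n) \<le> a" and k_ge: "real (k n) * norm (u n) \<ge> a / 2" for n
    proof -
      have pos: "norm (u n) > 0" using u(2) by simp
      have f: "real (k n) = of_int \<lfloor>a / norm (u n)\<rfloor>" using a by (simp add: k_def)
      have "real (k n) \<le> a / norm (u n)" unfolding f by linarith
      then show "real (k n) * norm (u n) \<le> a" using pos by (simp add: field_simps)
      have "real (k n) \<ge> a / norm (u n) - 1" unfolding f by linarith
      then have "real (k n) * norm (u n) \<ge> (a / norm (u n) - 1) * norm (u n)" using pos by simp
      then show "real (k n) * norm (u n) \<ge> a / 2" using ua[of n] pos by (simp add: algebra_simps)
    qed
    define p where "p n = real (k n) *\<^sub>R u n" for n
    have "p n \<in> S" for n using mult[OF u(1)] k_le by (simp add: p_def)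
    then obtain q r where q: "q \<in> S" "strict_mono r" "(p \<circ> r) \<longlonglongrightarrow> q"
      using S(1) unfolding compact_def by metis
    have pos: "t *\<^sub>R q \<in> S" if t: "0 \<le> t" "t \<le> 1" for t
    proof -
      \<comment> \<open>Rounding \<open>t * k n\<close> down costs at most
        \<open>norm (u n)\<close>, which tends to 0, so multiples of \<open>u (r n)\<close> lying in
        \<open>S\<close> converge to \<open>t *\<^sub>R q\<close>.\<close>
      define m where "m n = nat \<lfloor>t * k n\<rfloor>" for n
      have m: "real (m n) \<le> t * k n" "\<bar>t * k n - real (m n)\<bar> \<le> 1" for n
      proof -
        have f: "real (m n) = of_int \<lfloor>t * k n\<rfloor>" using t by (simp add: m_def)
        show "real (m n) \<le> t * k n" unfolding f by linarith
        show "\<bar>t * k n - real (m n)\<bar> \<le> 1" unfolding f by linarith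
      qed
      have in_S: "real (m n) *\<^sub>R u n \<in> S" for n
      proof (rule mult[OF u(1)])
        have "t * real (k n) \<le> 1 * real (k n)" using t by (intro mult_right_mono) auto
        then have "real (m n) \<le> real (k n)" using m(1)[of n] by linarith
        then have "real (m n) * norm (u n) \<le> real (k n) * norm (u n)" by (intro mult_right_mono) auto
        then show "norm (real (m n) *\<^sub>R u n) \<le> a" using k_le[of n] by simp
      qed
      have "norm (real (m n) *\<^sub>R u n - t *\<^sub>R p n) \<le> norm (u n)" for n
      proof -
        have "real (m n) *\<^sub>R u n - t *\<^sub>R p n = (real (m n) - t * k n) *\<^sub>R u n"
          by (simp add: p_def algebra_simps)
        then have "norm (real (m n) *\<^sub>R u n - t *\<^sub>R p n) = \<bar>t * k n - real (m n)\<bar> * norm (u n)"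
          by (simp add: abs_minus_commute)
        also have "\<dots> \<le> 1 * norm (u n)" using m(2) by (intro mult_right_mono) auto
        finally show ?thesis by simp
      qed
      then have "\<forall>\<^sub>F n in sequentially. norm (real (m n) *\<^sub>R u n - t *\<^sub>R p n) \<le> norm (u n)"
        by (intro always_eventually) blast
      then have "(\<lambda>n. real (m n) *\<^sub>R u n - t *\<^sub>R p n) \<longlonglongrightarrow> 0"
        using tendsto_norm_zero[OF u0] by (rule Lim_null_comparison)
      from LIMSEQ_subseq_LIMSEQ[OF this q(2)]
      have "(\<lambda>n. (real (m (r n)) *\<^sub>R u (r n) - t *\<^sub>R p (r n)) + t *\<^sub>R p (r n)) \<longlonglongrightarrow> 0 + t *\<^sub>R q"
        using q(3) by (intro tendsto_add tendsto_scaleR tendsto_const) (auto simp: o_def)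
      then have "(\<lambda>n. real (m (r n)) *\<^sub>R u (r n)) \<longlonglongrightarrow> t *\<^sub>R q" by simp
      then show ?thesis using closed_sequentially[OF compact_imp_closed[OF S(1)], of "\<lambda>n. real (m (r n)) *\<^sub>R u (r n)"] in_S
        by blast
    qed
    have "t *\<^sub>R q \<in> S" if "\<bar>t\<bar> \<le> 1" for t
    proof (cases "t \<ge> 0")
      case False
      then show ?thesis using S(3)[OF pos[of "-t"]] that by simp
    qed (use that pos in simp)
    then have qL: "q \<in> L" unfolding L_def by (auto intro: exI[of _ 1])
    \<comment> \<open>Scaled by \<open>k n\<close>, the distance of \<open>u n\<close> from
      \<open>L\<close> keeps \<open>p n\<close> away from \<open>q \<in> L\<close>, although a
      subsequence tends to \<open>q\<close>.\<close>
    have "norm (p n - q) \<ge> a / 2" for n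
    proof -
      have k0: "k n \<noteq> 0" using k_ge[of n] a by (intro notI) simp
      have "p n - q = real (k n) *\<^sub>R (u n - (1 / k n) *\<^sub>R q)" using k0 by (simp add: p_def algebra_simps)
      then have "norm (p n - q) = real (k n) * norm (u n - (1 / k n) *\<^sub>R q)" by simp
      also have "\<dots> \<ge> real (k n) * norm (u n)" using u(4) L_scale[OF qL] by (simp add: mult_left_mono)
      finally show ?thesis using k_ge[of n] by linarith
    qed
    moreover have "(\<lambda>n. norm (p (r n) - q)) \<longlonglongrightarrow> 0"
      using q(3) by (simp add: o_def tendsto_norm_zero_iff LIM_zero_iff)
    ultimately have "a / 2 \<le> 0" by (intro LIMSEQ_le_const) auto
    then show False using a by simp
  qed
  then obtain b where b: "0 < b" "b \<le> a" "S \<inter> cball 0 b \<subseteq> L" by blast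
  then have "S \<inter> cball 0 b = L \<inter> cball 0 b" using Lc by auto
  then show ?thesis using that L b by blast
qed

section \<open>Locally compact groups\<close>

lemma compact_circle_functions: "compact {f :: 'i \<Rightarrow> complex. \<forall>x. norm (f x) = 1}"
proof -
  have "compactin (product_topology (\<lambda>_::'i. euclidean :: complex topology) UNIV)
      (PiE UNIV (\<lambda>_. sphere 0 1))"
    by (simp add: compactin_PiE)
  moreover have "PiE UNIV (\<lambda>_. sphere 0 1) = {f :: 'i \<Rightarrow> complex. \<forall>x. norm (f x) = 1}"
    by (auto simp: PiE_def Pi_def)
  ultimately show ?thesis by (simp add: euclidean_product_topology)
qed

lemma closed_dist_eval_le: "closed {f :: 'i \<Rightarrow> 'm::metric_space. dist (f x) c \<le> d}"
  by (intro closed_Collect_le continuous_on_dist continuous_on_const continuous_on_product_coordinates)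

lemma closed_dist_eval_ge: "closed {f :: 'i \<Rightarrow> 'm::metric_space. dist (f x) c \<ge> d}"
  by (intro closed_Collect_le continuous_on_dist continuous_on_const continuous_on_product_coordinates)

lemma closed_circle_homs: "closed {h :: 'a::ab_group_add \<Rightarrow> complex. circle_hom h}"
proof -
  have "{h :: 'a \<Rightarrow> complex. circle_hom h} =
      (\<Inter>x. {h. norm (h x) = 1}) \<inter> (\<Inter>x. \<Inter>y. {h. h (x + y) = h x * h y})"
    by (auto simp: circle_hom_def)
  also have "closed \<dots>"
    by (intro closed_Int closed_INT ballI closed_Collect_eq continuous_intros
        continuous_on_product_coordinates)
  finally show ?thesis .
qed

text \<open>\<open>K\<close> will be compact in a product over the whole group, where sequences need
  not have convergent subsequences. A cluster point along the indices in \<open>J\<close> still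
  inherits every closed condition that eventually holds on \<open>J\<close>.\<close>

lemma cluster_point_in_closed:
  assumes K: "compact K" and X: "\<And>n. X n \<in> K" and J: "infinite (J :: nat set)"
  obtains p where "p \<in> K"
    "\<And>C. closed C \<Longrightarrow> \<forall>\<^sub>F n in sequentially. n \<in> J \<longrightarrow> X n \<in> C \<Longrightarrow> p \<in> C"
proof -
  define F where "F = filtermap X (inf sequentially (principal J))"
  have "\<not> (\<forall>\<^sub>F n in sequentially. n \<notin> J)"
    using J by (auto simp: eventually_sequentially infinite_nat_iff_unbounded_le)
  then have "F \<noteq> bot"
    by (simp add: F_def trivial_limit_def eventually_filtermap eventually_inf_principal)
  moreover have "eventually (\<lambda>x. x \<in> K) F"
    using X by (simp add: F_def eventually_filtermap)
  ultimately obtain p where p: "p \<in> K" "inf (nhds p) F \<noteq> bot"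
    using K unfolding compact_filter by blast
  have "p \<in> C" if C: "closed C" "\<forall>\<^sub>F n in sequentially. n \<in> J \<longrightarrow> X n \<in> C" for C
  proof (rule ccontr)
    assume "p \<notin> C"
    then have "eventually (\<lambda>x. x \<in> - C) (nhds p)"
      using C(1) by (intro eventually_nhds_in_open) auto
    moreover have "eventually (\<lambda>x. x \<in> C) F"
      using C(2) by (simp add: F_def eventually_filtermap eventually_inf_principal)
    ultimately have "eventually (\<lambda>x. False) (inf (nhds p) F)"
      unfolding eventually_inf by blast
    then show False using p(2) by (simp add: trivial_limit_def)
  qed
  then show ?thesis using p(1) that by blast
qed

text \<open>If all \<open>U n - W\<close> were nonempty, they would be nested closed subsets of the
  compact \<open>U 0\<close> and share a point, which \<open>W\<close> excludes.\<close>

lemma compact_decseq_subset_open: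
  assumes H: "Hausdorff_space X" and U: "\<And>n::nat. compactin X (U n)" and dec: "\<And>n. U (Suc n) \<subseteq> U n"
    and W: "openin X W" "(\<Inter>n. U n) \<subseteq> W"
  obtains n where "U n \<subseteq> W"
proof -
  have cl: "closedin X (U n)" for n using compactin_imp_closedin[OF H U] .
  have dec': "decseq U" using dec by (simp add: decseq_Suc_iff)
  have "\<exists>n. U n - W = {}"
  proof (rule ccontr)
    assume ne: "\<nexists>n. U n - W = {}"
    have sub: "U n - W \<subseteq> U 0" for n using dec' by (auto dest: decseqD[of U 0 n])
    have "(\<Inter>n. U n - W) \<noteq> {}"
    proof (rule compact_space_imp_nest)
      show "compact_space (subtopology X (U 0))" using U by (simp add: compact_space_subtopology)
      show "closedin (subtopology X (U 0)) (U n - W)" for n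
        using closedin_diff[OF cl W(1)] sub by (simp add: closedin_subset_topspace)
      show "decseq (\<lambda>n. U n - W)" using dec' by (auto simp: decseq_def)
    qed (use ne in blast)
    then show False using W(2) by blast
  qed
  then show ?thesis using that by blast
qed

lemma dual_group_iff:
  "h \<in> dual_group T \<longleftrightarrow> circle_hom h \<and> continuous_map T euclidean h" if "topspace T = UNIV"
  using that by (auto simp: dual_group_def circle_hom_def continuous_map_in_subtopology)

text \<open>The product topology is the class topology of the function type, so the family depends
  on \<open>T\<close> only through \<open>dual_group T\<close>.\<close>

lemma K_family_iff: "K \<in> K_family T \<longleftrightarrow> compact K \<and> K \<subseteq> dual_group T"
  by (simp add: K_family_def pointwise_topology_def euclidean_product_topology compactin_subtopology
      conj_commute)

section \<open>Neighbourhoods of 0 in a locally compact group\<close>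

locale lc_group =
  fixes T :: "'a::ab_group_add topology"
  assumes group_top: "group_topology T"
    and Hausdorff: "Hausdorff_space T"
    and locally_compact: "locally_compact_space T"
begin

definition nbhd0 :: "'a set \<Rightarrow> bool" where
  "nbhd0 U \<longleftrightarrow> (\<exists>W. openin T W \<and> 0 \<in> W \<and> W \<subseteq> U)"

lemma topspace_UNIV [simp]: "topspace T = UNIV"
  using group_top by (simp add: group_topology_def)

lemma continuous_map_plus:
  assumes "continuous_map X T f" "continuous_map X T g"
  shows "continuous_map X T (\<lambda>x. f x + g x)"
  using continuous_map_compose[OF continuous_map_pairedI[OF assms], of T "\<lambda>(x, y). x + y"] group_top
  by (simp add: group_topology_def o_def)

lemma continuous_map_uminus:
  assumes "continuous_map X T f"
  shows "continuous_map X T (\<lambda>x. - f x)"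
  using continuous_map_compose[OF assms, of T uminus] group_top
  by (simp add: group_topology_def o_def)

lemma continuous_map_translate: "continuous_map T T (\<lambda>x. x + c)"
  by (intro continuous_map_plus continuous_map_id[unfolded id_def]) simp

lemma openin_translate:
  assumes "openin T W" shows "openin T {x. x + c \<in> W}"
  using openin_continuous_map_preimage[OF continuous_map_translate assms] by simp

lemma nbhd0_mono: "nbhd0 U \<Longrightarrow> U \<subseteq> V \<Longrightarrow> nbhd0 V"
  unfolding nbhd0_def by blast

lemma nbhd0_Int:
  assumes "nbhd0 U" "nbhd0 V" shows "nbhd0 (U \<inter> V)"
proof -
  obtain W W' where "openin T W" "0 \<in> W" "W \<subseteq> U" "openin T W'" "0 \<in> W'" "W' \<subseteq> V"
    using assms unfolding nbhd0_def by blast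
  then show ?thesis unfolding nbhd0_def by (intro exI[of _ "W \<inter> W'"]) auto
qed

lemma nbhd0_openin: "openin T W \<Longrightarrow> 0 \<in> W \<Longrightarrow> nbhd0 W"
  unfolding nbhd0_def by blast

lemma zero_in_nbhd0: "nbhd0 U \<Longrightarrow> 0 \<in> U"
  unfolding nbhd0_def by blast

lemma nbhd0_uminus:
  assumes "nbhd0 U" shows "nbhd0 {x. - x \<in> U}"
proof -
  obtain W where W: "openin T W" "0 \<in> W" "W \<subseteq> U" using assms unfolding nbhd0_def by blast
  have "openin T {x \<in> topspace T. - x \<in> W}"
    by (rule openin_continuous_map_preimage[OF _ W(1)])
      (intro continuous_map_uminus continuous_map_id[unfolded id_def])
  then show ?thesis using W unfolding nbhd0_def by (intro exI[of _ "{x. - x \<in> W}"]) auto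
qed

lemma openin_via_nbhd0:
  assumes "\<And>x. x \<in> U \<Longrightarrow> nbhd0 {y. x + y \<in> U}"
  shows "openin T U"
proof (subst openin_subopen, intro ballI)
  fix x assume "x \<in> U"
  then obtain W where W: "openin T W" "0 \<in> W" "W \<subseteq> {y. x + y \<in> U}"
    using assms unfolding nbhd0_def by blast
  have "y \<in> U" if "y + - x \<in> W" for y
    using subsetD[OF W(3) that] by simp
  moreover have "x \<in> {y. y + - x \<in> W}" using W(2) by simp
  ultimately show "\<exists>V. openin T V \<and> x \<in> V \<and> V \<subseteq> U"
    using openin_translate[OF W(1), of "- x"] by (intro exI[of _ "{y. y + - x \<in> W}"]) blast
qed

lemma nbhd0_translate:
  assumes "openin T W" "x \<in> W" shows "nbhd0 {y. x + y \<in> W}"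
  using openin_translate[OF assms(1), of x] assms(2)
  by (intro nbhd0_openin) (simp_all add: add.commute[of x])

lemma nbhd0_half:
  assumes "nbhd0 U"
  obtains V where "nbhd0 V" "\<And>x y. x \<in> V \<Longrightarrow> y \<in> V \<Longrightarrow> x + y \<in> U \<and> x - y \<in> U"
proof -
  obtain W where W: "openin T W" "0 \<in> W" "W \<subseteq> U" using assms unfolding nbhd0_def by blast
  define P where "P = {p \<in> topspace (prod_topology T T). fst p + snd p \<in> W}"
  have "openin (prod_topology T T) P" unfolding P_def
    by (rule openin_continuous_map_preimage[OF _ W(1)])
      (intro continuous_map_plus continuous_map_fst continuous_map_snd)
  moreover have "(0, 0) \<in> P" using W by (simp add: P_def)
  ultimately have "\<exists>A B. openin T A \<and> openin T B \<and> 0 \<in> A \<and> 0 \<in> B \<and> A \<times> B \<subseteq> P"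
    unfolding openin_prod_topology_alt by (elim allE impE)
  then obtain A B where A: "openin T A" "openin T B" "0 \<in> A" "0 \<in> B" "A \<times> B \<subseteq> P"
    by (elim exE conjE)
  define V where "V = (A \<inter> B) \<inter> {x. - x \<in> A \<inter> B}"
  have "nbhd0 V" unfolding V_def
    by (intro nbhd0_Int nbhd0_uminus nbhd0_openin openin_Int) (use A in auto)
  moreover have "x + y \<in> U \<and> x - y \<in> U" if xy: "x \<in> V" "y \<in> V" for x y
  proof -
    have "(x, y) \<in> A \<times> B" "(x, - y) \<in> A \<times> B" using xy by (auto simp: V_def)
    then have "(x, y) \<in> P" "(x, - y) \<in> P" using subsetD[OF A(5)] by simp_all
    then have "fst (x, y) + snd (x, y) \<in> W" "fst (x, - y) + snd (x, - y) \<in> W" by (simp_all add: P_def)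
    then show ?thesis using W(3) by auto
  qed
  ultimately show ?thesis using that by blast
qed

lemma compact_nbhd0:
  assumes "nbhd0 U"
  obtains V where "compactin T V" "nbhd0 V" "V \<subseteq> U" "\<And>x. x \<in> V \<Longrightarrow> - x \<in> V"
proof -
  obtain W where W: "openin T W" "0 \<in> W" "W \<subseteq> U" using assms unfolding nbhd0_def by blast
  have "neighbourhood_base_of (compactin T) T"
    using locally_compact_imp_neighbourhood_base locally_compact
      locally_compact_Hausdorff_imp_regular_space Hausdorff by blast
  then obtain A C where C: "openin T A" "compactin T C" "0 \<in> A" "A \<subseteq> C" "C \<subseteq> W"
    using W unfolding neighbourhood_base_of by meson
  have "closedin T {x \<in> topspace T. - x \<in> C}"
    by (rule closedin_continuous_map_preimage[OF _ compactin_imp_closedin[OF Hausdorff C(2)]])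
      (intro continuous_map_uminus continuous_map_id[unfolded id_def])
  then have "compactin T (C \<inter> {x. - x \<in> C})" using compact_Int_closedin[OF C(2)] by simp
  moreover have "nbhd0 (C \<inter> {x. - x \<in> C})"
    using C by (intro nbhd0_Int nbhd0_uminus) (auto simp: nbhd0_def)
  ultimately show ?thesis using that[of "C \<inter> {x. - x \<in> C}"] C W by auto
qed

lemma nbhd0_dual:
  assumes "h \<in> dual_group T" "e > 0" shows "nbhd0 {x. dist (h x) 1 < e}"
proof (rule nbhd0_openin)
  have h: "circle_hom h" "continuous_map T euclidean h" using assms(1) by (simp_all add: dual_group_iff)
  have "openin T {x \<in> topspace T. h x \<in> ball 1 e}"
    by (rule openin_continuous_map_preimage[OF h(2)]) simp
  then show "openin T {x. dist (h x) 1 < e}" by (simp add: dist_commute)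
  show "0 \<in> {x. dist (h x) 1 < e}" using assms(2) circle_hom_zero[OF h(1)] by simp
qed

text \<open>Continuity at 0 spreads everywhere because
  \<open>dist (h (x + y)) (h x) = dist (h y) 1\<close>.\<close>

lemma dual_groupI:
  assumes h: "circle_hom h" and nb: "\<And>e. e > 0 \<Longrightarrow> nbhd0 {x. dist (h x) 1 < e}"
  shows "h \<in> dual_group T"
proof -
  have "openin T {x \<in> topspace T. h x \<in> V}" if V: "open V" for V
  proof (rule openin_via_nbhd0)
    fix x assume "x \<in> {x \<in> topspace T. h x \<in> V}"
    then obtain e where e: "e > 0" "ball (h x) e \<subseteq> V" using V open_contains_ball by blast
    have "dist (h (x + y)) (h x) = dist (h y) 1" for y
      using circle_hom_dist[OF h, of "x + y" x] by simp
    then have "{y. dist (h y) 1 < e} \<subseteq> {y. x + y \<in> {x \<in> topspace T. h x \<in> V}}"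
      using e(2) by (auto simp: dist_commute)
    then show "nbhd0 {y. x + y \<in> {x \<in> topspace T. h x \<in> V}}" using nb[OF e(1)] nbhd0_mono by blast
  qed
  then have "continuous_map T euclidean h" by (simp add: continuous_map_def)
  then show ?thesis using h by (simp add: dual_group_iff)
qed

end

section \<open>Equicontinuity of pointwise compact sets of characters\<close>

lemma (in lc_group) K_family_equicontinuous:
  assumes K: "K \<in> K_family T" and e: "e > 0"
  shows "nbhd0 {x. \<forall>h\<in>K. dist (h x) 1 < e}"
proof (rule ccontr)
  assume neg: "\<not> ?thesis"
  have Kc: "compact K" and Kd: "\<And>h. h \<in> K \<Longrightarrow> h \<in> dual_group T" using K by (auto simp: K_family_iff)
  have Kh: "circle_hom h" if "h \<in> K" for h using Kd[OF that] by (simp add: dual_group_iff)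
  have Kcont: "continuous_map T euclidean h" if "h \<in> K" for h using Kd[OF that] by (simp add: dual_group_iff)
  define P where "P U \<longleftrightarrow> compactin T U \<and> nbhd0 U" for U
  \<comment> \<open>\<open>Q\<close> ties the next neighbourhood to a failure on the current one:
    \<open>h\<close> is far from 1 somewhere on \<open>U\<close> but within 1/2 of 1 on
    \<open>U'\<close>. Halving makes the intersection of the sequence a subgroup.\<close>
  define Q where "Q U U' \<longleftrightarrow> (\<exists>h\<in>K. \<exists>x\<in>U. dist (h x) 1 \<ge> e \<and> (\<forall>y\<in>U'. dist (h y) 1 \<le> 1/2))
      \<and> (\<forall>x\<in>U'. \<forall>y\<in>U'. x + y \<in> U \<and> x - y \<in> U)" for U U'
  have "\<exists>U :: nat \<Rightarrow> 'a set. \<forall>n. P (U n) \<and> Q (U n) (U (Suc n))"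
  proof (rule dependent_nat_choice)
    have "nbhd0 UNIV" by (rule nbhd0_openin) (use openin_topspace[of T] in simp_all)
    then show "\<exists>U. P U" using compact_nbhd0 unfolding P_def by metis
  next
    fix U assume U: "P U"
    have "\<not> U \<subseteq> {x. \<forall>h\<in>K. dist (h x) 1 < e}" using U neg nbhd0_mono unfolding P_def by blast
    then obtain x h where xh: "x \<in> U" "h \<in> K" "dist (h x) 1 \<ge> e" unfolding not_less[symmetric] by blast
    obtain V where V: "nbhd0 V" "\<And>x y. x \<in> V \<Longrightarrow> y \<in> V \<Longrightarrow> x + y \<in> U \<and> x - y \<in> U"
      using nbhd0_half U unfolding P_def by metis
    obtain U' where U': "compactin T U'" "nbhd0 U'" "U' \<subseteq> V \<inter> {x. dist (h x) 1 < 1/2}"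
      using compact_nbhd0[OF nbhd0_Int[OF V(1) nbhd0_dual[OF Kd[OF xh(2)]]], of "1/2"]
      by (metis half_gt_zero zero_less_one)
    have "dist (h y) 1 \<le> 1/2" if "y \<in> U'" for y using subsetD[OF U'(3) that] by simp
    then have "Q U U'" using xh V(2) U'(3) unfolding Q_def by blast
    then show "\<exists>U'. P U' \<and> Q U U'" using U' unfolding P_def by blast
  qed
  then obtain U :: "nat \<Rightarrow> 'a set" where U: "\<And>n. compactin T (U n)" "\<And>n. nbhd0 (U n)"
      and UQ: "\<And>n. Q (U n) (U (Suc n))"
    unfolding P_def by blast
  have U_half: "x + y \<in> U n \<and> x - y \<in> U n" if "x \<in> U (Suc n)" "y \<in> U (Suc n)" for x y n
    using UQ that unfolding Q_def by blast
  have U0: "0 \<in> U n" for n using zero_in_nbhd0[OF U(2)] .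
  have U_dec: "U (Suc n) \<subseteq> U n" for n using U_half[OF _ U0] by force
  have U_anti: "U m \<subseteq> U n" if "n \<le> m" for m n using lift_Suc_antimono_le[of U, OF U_dec that] .
  have "\<forall>n. \<exists>h x. h \<in> K \<and> x \<in> U n \<and> dist (h x) 1 \<ge> e \<and> (\<forall>y\<in>U (Suc n). dist (h y) 1 \<le> 1/2)"
    using UQ unfolding Q_def by blast
  then obtain X x where X: "\<And>n. X n \<in> K" and x: "\<And>n. x n \<in> U n"
      and far: "\<And>n. dist (X n (x n)) 1 \<ge> e"
      and near: "\<And>n y. y \<in> U (Suc n) \<Longrightarrow> dist (X n y) 1 \<le> 1/2"
    by metis
  define N where "N = (\<Inter>n. U n)"
  have N_diff: "y - z \<in> N" and N_add: "y + z \<in> N" if "y \<in> N" "z \<in> N" for y z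
    using U_half that unfolding N_def by blast+
  have N0: "0 \<in> N" using U0 by (simp add: N_def)
  have N_ntimes: "ntimes n y \<in> N" if "y \<in> N" for n y
    by (induction n) (auto simp: N0 N_add that)
  \<comment> \<open>Multiples of \<open>y\<close> stay in the subgroup \<open>N\<close>, where
    \<open>X n\<close> is within 1/2 of 1; by \<open>circle_power_away\<close> it is trivial
    there.\<close>
  have X_N: "X n y = 1" if "y \<in> N" for n y
  proof (rule ccontr)
    assume "X n y \<noteq> 1"
    then obtain m where "dist (X n y ^ m) 1 > 1/2" using circle_power_away by blast
    then have "dist (X n (ntimes m y)) 1 > 1/2" by (simp add: circle_hom_ntimes[OF Kh[OF X]])
    moreover have "ntimes m y \<in> U (Suc n)" using N_ntimes[OF that] by (auto simp: N_def)
    ultimately show False using near by force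
  qed
  have small_on_U: "\<exists>n. \<forall>u\<in>U n. dist (p u) 1 < d" if p: "p \<in> K" "\<And>y. y \<in> N \<Longrightarrow> p y = 1" and d: "d > 0" for p d
  proof -
    have "openin T {x \<in> topspace T. p x \<in> ball 1 d}"
      by (rule openin_continuous_map_preimage[OF Kcont[OF p(1)]]) simp
    moreover have "(\<Inter>n. U n) \<subseteq> {x \<in> topspace T. p x \<in> ball 1 d}" using p(2) d by (auto simp: N_def)
    ultimately obtain n where "U n \<subseteq> {x \<in> topspace T. p x \<in> ball 1 d}"
      using compact_decseq_subset_open[of T U, OF Hausdorff U(1) U_dec] by metis
    then show ?thesis by (auto simp: dist_commute)
  qed
  \<comment> \<open>A countable monoid, indexed by finite lists of naturals. Restrictions to it live
    in a countable product of circles, which is sequentially compact.\<close>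
  define D where "D = range (\<lambda>l. sum_list (map x l))"
  define dd where "dd k = sum_list (map x (from_nat k))" for k
  have dd: "dd k \<in> D" for k by (simp add: dd_def D_def)
  have dd_surj: "\<exists>k. y = dd k" if y: "y \<in> D" for y
  proof -
    obtain l where "y = sum_list (map x l)" using y by (auto simp: D_def)
    then have "y = dd (to_nat l)" by (simp add: dd_def)
    then show ?thesis by blast
  qed
  have D_add: "y + z \<in> D" if y: "y \<in> D" and z: "z \<in> D" for y z
  proof -
    obtain l m where "y = sum_list (map x l)" "z = sum_list (map x m)" using y z by (auto simp: D_def)
    then have "y + z = sum_list (map x (l @ m))" by simp
    then show ?thesis unfolding D_def by blast
  qed
  have D_x: "x n \<in> D" for n
  proof -
    have "x n = sum_list (map x [n])" by simp
    then show ?thesis unfolding D_def by blast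
  qed
  have D0: "0 \<in> D"
  proof -
    have "0 = sum_list (map x [])" by simp
    then show ?thesis unfolding D_def by blast
  qed
  obtain l r where r: "strict_mono (r :: nat \<Rightarrow> nat)"
      and lim: "(\<lambda>n. (\<lambda>k. X (r n) (dd k))) \<longlonglongrightarrow> l"
  proof -
    have "seq_compact {f :: nat \<Rightarrow> complex. \<forall>x. norm (f x) = 1}"
      by (rule compact_imp_seq_compact[OF compact_circle_functions])
    moreover have "\<forall>n. (\<lambda>k. X n (dd k)) \<in> {f. \<forall>x. norm (f x) = 1}"
      using Kh[OF X] by (simp add: circle_hom_def)
    ultimately obtain l r where "strict_mono (r :: nat \<Rightarrow> nat)" "((\<lambda>n k. X n (dd k)) \<circ> r) \<longlonglongrightarrow> l"
      by (rule seq_compactE) 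
    then show ?thesis using that by (simp add: o_def)
  qed
  have lim_k: "(\<lambda>n. X (r n) (dd k)) \<longlonglongrightarrow> l k" for k
    using continuous_on_tendsto_compose[OF continuous_on_product_coordinates[of k] lim] by simp
  \<comment> \<open>What all cluster points of the chosen subsequence share, and enough to determine
    a character on the set \<open>S\<close> below.\<close>
  define good where "good p \<longleftrightarrow> p \<in> K \<and> (\<forall>y\<in>N. p y = 1) \<and> (\<forall>k. p (dd k) = l k)" for p
  have ex_good: "\<exists>p. good p \<and> (\<forall>C. closed C \<longrightarrow> (\<forall>n\<in>J. X (r n) \<in> C) \<longrightarrow> p \<in> C)" if J: "infinite J" for J
  proof -
    obtain p where p: "p \<in> K" and pC: "\<And>C. closed C \<Longrightarrow> \<forall>\<^sub>F n in sequentially. n \<in> J \<longrightarrow> X (r n) \<in> C \<Longrightarrow> p \<in> C"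
      using cluster_point_in_closed[OF Kc _ J, of "\<lambda>n. X (r n)"] X by blast
    have "p y = 1" if "y \<in> N" for y
    proof -
      have "p \<in> {f. dist (f y) 1 \<le> 0}"
        by (rule pC[OF closed_dist_eval_le]) (simp add: X_N[OF that])
      then show ?thesis by simp
    qed
    moreover have "p (dd k) = l k" for k
    proof -
      have "dist (p (dd k)) (l k) \<le> 0 + d" if d: "d > 0" for d
      proof -
        have "\<forall>\<^sub>F n in sequentially. dist (X (r n) (dd k)) (l k) < d" using lim_k d by (rule tendstoD)
        then have "\<forall>\<^sub>F n in sequentially. n \<in> J \<longrightarrow> X (r n) \<in> {f. dist (f (dd k)) (l k) \<le> d}"
          by (rule eventually_mono) simp
        then have "p \<in> {f. dist (f (dd k)) (l k) \<le> d}" by (rule pC[OF closed_dist_eval_le])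
        then show ?thesis by simp
      qed
      then have "dist (p (dd k)) (l k) \<le> 0" by (rule field_le_epsilon)
      then show ?thesis by simp
    qed
    moreover have "p \<in> C" if "closed C" "\<forall>n\<in>J. X (r n) \<in> C" for C
      using pC[OF that(1)] that(2) by (simp add: always_eventually)
    ultimately show ?thesis using p unfolding good_def by blast
  qed
  \<comment> \<open>The intersection of the sets \<open>D + U n\<close>: a closed monoid containing
    \<open>N\<close>, not claimed to be a group.\<close>
  define S where "S = {y. \<forall>n. \<exists>d\<in>D. y - d \<in> U n}"
  \<comment> \<open>The two characters agree on \<open>D\<close>, and a point of \<open>S\<close>
    differs from a point of \<open>D\<close> by an element at which both are close to 1.\<close>
  have good_unique: "p y = q y" if p: "good p" and q: "good q" and y: "y \<in> S" for p q y
  proof -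
    have "dist (p y) (q y) \<le> 0 + d" if d: "d > 0" for d
    proof -
      obtain m where m: "\<And>u. u \<in> U m \<Longrightarrow> dist (p u) 1 < d / 2"
        using small_on_U[of p "d / 2"] p d by (auto simp: good_def)
      obtain n where n: "\<And>u. u \<in> U n \<Longrightarrow> dist (q u) 1 < d / 2"
        using small_on_U[of q "d / 2"] q d by (auto simp: good_def)
      obtain c where c: "c \<in> D" "y - c \<in> U (max m n)" using y by (auto simp: S_def)
      have "p c = q c" using dd_surj[OF c(1)] p q by (auto simp: good_def)
      moreover have "p y = p (y - c) * p c" "q y = q (y - c) * q c" "norm (q c) = 1"
        using p q Kh unfolding good_def circle_hom_def by (metis diff_add_cancel)+
      ultimately have "dist (p y) (q y) = dist (p (y - c)) (q (y - c))"
        by (simp add: dist_norm norm_mult flip: left_diff_distrib)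
      also have "\<dots> \<le> dist (p (y - c)) 1 + dist (q (y - c)) 1" by (rule dist_triangle2)
      also have "\<dots> \<le> d / 2 + d / 2"
        using m n c(2) U_anti[of m "max m n"] U_anti[of n "max m n"] by (intro add_mono less_imp_le) auto
      finally show ?thesis by simp
    qed
    then have "dist (p y) (q y) \<le> 0" by (rule field_le_epsilon)
    then show ?thesis by simp
  qed
  obtain p where p: "good p" using ex_good[of UNIV] by auto
  have pK: "p \<in> K" using p by (simp add: good_def)
  \<comment> \<open>If convergence failed at \<open>y\<close>, it would fail along an infinite index
    set; a cluster point along that set is good yet differs from \<open>p\<close> at
    \<open>y\<close>.\<close>
  have conv: "(\<lambda>n. X (r n) y) \<longlonglongrightarrow> p y" if y: "y \<in> S" for y
  proof (rule tendstoI, rule ccontr)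
    fix d :: real assume d: "d > 0" "\<not> (\<forall>\<^sub>F n in sequentially. dist (X (r n) y) (p y) < d)"
    then have "infinite {n. dist (X (r n) y) (p y) \<ge> d}"
      by (simp add: eventually_sequentially infinite_nat_iff_unbounded_le not_less)
    from ex_good[OF this] obtain q where q: "good q"
      and "\<And>C. closed C \<Longrightarrow> \<forall>n\<in>{n. dist (X (r n) y) (p y) \<ge> d}. X (r n) \<in> C \<Longrightarrow> q \<in> C" by blast
    from this(2)[OF closed_dist_eval_ge[of d y "p y"]] have "dist (q y) (p y) \<ge> d" by simp
    then show False using good_unique[OF q p y] d(1) by simp
  qed
  have S_add: "y + z \<in> S" if y: "y \<in> S" and z: "z \<in> S" for y z
    unfolding S_def
  proof (intro CollectI allI)
    fix n
    obtain c c' where "c \<in> D" "y - c \<in> U (Suc n)" "c' \<in> D" "z - c' \<in> U (Suc n)"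
      using y z unfolding S_def by blast
    then show "\<exists>d\<in>D. y + z - d \<in> U n"
      using U_half[of "y - c" n "z - c'"] D_add[of c c'] by (intro bexI[of _ "c + c'"]) (auto simp: algebra_simps)
  qed
  have N_S: "y \<in> S" if "y \<in> N" for y
    using that D0 unfolding S_def N_def by (auto intro!: bexI[of _ 0])
  have x_S: "x n \<in> S" for n
    using D_x U0 unfolding S_def by (auto intro!: bexI[of _ "x n"])
  have "openin T (- S)"
  proof (rule openin_via_nbhd0)
    fix y assume "y \<in> - S"
    then obtain n where n: "\<And>d. d \<in> D \<Longrightarrow> y - d \<notin> U n" unfolding S_def by blast
    have "y + u \<notin> S" if u: "u \<in> U (Suc n)" for u
    proof
      assume "y + u \<in> S"
      then obtain d where d: "d \<in> D" "y + u - d \<in> U (Suc n)" unfolding S_def by blast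
      then have "(y + u - d) - u \<in> U n" using U_half u by blast
      then show False using n[OF d(1)] by (simp add: algebra_simps)
    qed
    then show "nbhd0 {z. y + z \<in> - S}" by (intro nbhd0_mono[OF U(2)[of "Suc n"]]) auto
  qed
  then have S_closed: "closedin T S" by (simp add: closedin_def Compl_eq_Diff_UNIV)
  define TS where "TS = subtopology T S"
  \<comment> \<open>Closed sets that cover \<open>S\<close> by pointwise convergence. Baire's
    theorem gives one of them interior points, turning pointwise into uniform closeness near some
    \<open>y\<close>.\<close>
  define A where "A n = {y \<in> S. \<forall>m\<ge>n. dist (X (r m) y) (p y) \<le> e / 4}" for n :: nat
  have A_closed: "closedin TS (A n)" for n
  proof -
    have "closedin TS {y \<in> topspace TS. dist (X (r m) y) (p y) \<in> {..e/4}}" for m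
      unfolding TS_def
    proof (rule closedin_continuous_map_preimage)
      show "continuous_map (subtopology T S) euclidean (\<lambda>y. dist (X (r m) y) (p y))"
        unfolding dist_norm
        by (intro continuous_map_norm continuous_map_diff continuous_map_from_subtopology Kcont X pK)
    qed simp
    then have "closedin TS (\<Inter>m\<in>{n..}. {y \<in> topspace TS. dist (X (r m) y) (p y) \<in> {..e/4}})"
      by (intro closedin_Inter) auto
    moreover have "(\<Inter>m\<in>{n..}. {y \<in> topspace TS. dist (X (r m) y) (p y) \<in> {..e/4}}) = A n"
      by (auto simp: A_def TS_def)
    ultimately show ?thesis by simp
  qed
  have "S \<subseteq> (\<Union>n. A n)"
  proof
    fix y assume y: "y \<in> S"
    have "\<forall>\<^sub>F n in sequentially. dist (X (r n) y) (p y) < e / 4" using conv[OF y] e by (intro tendstoD) auto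
    then obtain n where "\<And>m. m \<ge> n \<Longrightarrow> dist (X (r m) y) (p y) < e / 4" by (auto simp: eventually_sequentially)
    then show "y \<in> (\<Union>n. A n)" using y by (auto simp: A_def intro!: less_imp_le)
  qed
  moreover have "(\<Union>n. A n) \<subseteq> S" by (auto simp: A_def)
  ultimately have UA: "\<Union>(range A) = topspace TS" by (auto simp: TS_def)
  have "\<exists>n. TS interior_of (A n) \<noteq> {}"
  proof (rule ccontr)
    assume "\<nexists>n. TS interior_of (A n) \<noteq> {}"
    then have "TS interior_of \<Union>(range A) = {}"
      using A_closed S_closed locally_compact_Hausdorff_imp_regular_space[OF locally_compact Hausdorff]
      by (intro Baire_category_alt) (auto simp: TS_def locally_compact_space_closed_subset[OF locally_compact]
          regular_space_subtopology)
    then have "TS interior_of topspace TS = {}" by (simp only: UA)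
    then have "topspace TS = {}" by (simp only: interior_of_topspace)
    then show False using N_S[OF N0] by (auto simp: TS_def)
  qed
  then obtain n y where y: "y \<in> TS interior_of (A n)" by blast
  then obtain G where G: "openin TS G" "y \<in> G" "G \<subseteq> A n" unfolding interior_of_def by blast
  then obtain W where W: "openin T W" "G = W \<inter> S" unfolding TS_def openin_subtopology by blast
  have yS: "y \<in> S" and yW: "y \<in> W" using G W by auto
  define B where "B = {z. y + z \<in> W} \<inter> {z. dist (p z) 1 < e / 4}"
  have "nbhd0 B" unfolding B_def
    using e by (intro nbhd0_Int nbhd0_translate W yW nbhd0_dual Kd pK) auto
  then obtain B' where B': "openin T B'" "0 \<in> B'" "B' \<subseteq> B" unfolding nbhd0_def by blast
  \<comment> \<open>The sets \<open>U n\<close> shrink to \<open>N\<close>, not to 0, so they are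
    only caught by \<open>B' + N\<close>; a shift by \<open>z \<in> N\<close> is invisible to the
    characters \<open>X n\<close>.\<close>
  define V where "V = (\<Union>z\<in>N. {w. w + (- z) \<in> B'})"
  have "openin T V" unfolding V_def by (intro openin_Union) (auto intro!: openin_translate[OF B'(1), of "- _", simplified])
  moreover have "(\<Inter>n. U n) \<subseteq> V" using B'(2) by (auto simp: V_def N_def intro!: bexI)
  ultimately obtain k where k: "U k \<subseteq> V" using compact_decseq_subset_open[of T U, OF Hausdorff U(1) U_dec] by metis
  \<comment> \<open>At least \<open>n\<close> for the closeness on \<open>A n\<close>, and at least
    \<open>k\<close> so that \<open>x (r m)\<close> lies in \<open>U k\<close>, as
    \<open>r m \<ge> m\<close>.\<close>
  define m where "m = max k n"
  have rm: "r m \<ge> m" using r by (rule seq_suble)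
  have "x (r m) \<in> V" using x[of "r m"] U_anti[of k "r m"] rm k by (auto simp: m_def)
  then obtain z where z: "z \<in> N" "x (r m) - z \<in> B'" by (auto simp: V_def)
  define w where "w = x (r m) - z"
  have wS: "w \<in> S"
    using S_add[OF x_S[of "r m"] N_S[OF N_diff[OF N0 z(1)]]] by (simp add: w_def)
  have wB: "w \<in> B" using z B' by (auto simp: w_def)
  let ?h = "X (r m)"
  have h: "circle_hom ?h" "circle_hom p" using Kh X pK by auto
  have mn: "m \<ge> n" by (simp add: m_def)
  have "y \<in> A n" "y + w \<in> A n" using G W yS wS S_add wB by (auto simp: B_def)
  then have c: "dist (?h y) (p y) \<le> e / 4" "dist (?h (y + w)) (p (y + w)) \<le> e / 4"
    using mn by (auto simp: A_def)
  \<comment> \<open>Comparing at \<open>y\<close> and \<open>y + w\<close>, both in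
    \<open>A n\<close>, recovers the value at \<open>w\<close> without inverses in
    \<open>S\<close>.\<close>
  have "(?h w - p w) * p y = (?h (y + w) - p (y + w)) - ?h w * (?h y - p y)"
    using h by (simp add: circle_hom_def algebra_simps)
  then have "norm (?h w - p w) = norm ((?h (y + w) - p (y + w)) - ?h w * (?h y - p y))"
    using h by (metis circle_hom_def norm_mult mult.right_neutral)
  also have "\<dots> \<le> norm (?h (y + w) - p (y + w)) + norm (?h w * (?h y - p y))" by (rule norm_triangle_ineq4)
  also have "\<dots> \<le> e / 4 + e / 4" using c h by (simp add: norm_mult dist_norm circle_hom_def)
  finally have "dist (?h w) (p w) \<le> e / 2" by (simp add: dist_norm)
  moreover have "dist (p w) 1 < e / 4" using wB by (simp add: B_def)
  ultimately have "dist (?h w) 1 < e" using dist_triangle[of "?h w" 1 "p w"] e by linarith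
  moreover have "?h w = ?h (x (r m))"
    using X_N[OF z(1), of "r m"] by (simp add: w_def circle_hom_diff[OF h(1)])
  ultimately show False using far[of "r m"] by simp
qed

section \<open>Logarithmic charts\<close>

lemma norm_cis_diff_1: "dist (cis t) 1 \<le> \<bar>t\<bar>"
  using dist_exp_i_1[of t] abs_sin_x_le_abs_x[of "t / 2"] by (simp add: dist_norm cis_conv_exp)

text \<open>A local homomorphism into a normed space; \<open>chart_add\<close> returns sums of small
  value to \<open>V\<close>, which makes the image a local subgroup. \<open>E\<close> and
  \<open>chart_bounded\<close> stand in for a finite-dimensional target.\<close>

locale lc_chart = lc_group T for T :: "'a::ab_group_add topology" +
  fixes V :: "'a set" and \<theta> :: "'a \<Rightarrow> 'v::real_normed_vector" and a :: real and E :: "'v set"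
  assumes V_compact: "compactin T V" and V_nbhd0: "nbhd0 V" and V_minus: "x \<in> V \<Longrightarrow> - x \<in> V"
    and chart_continuous: "continuous_map (subtopology T V) euclidean \<theta>"
    and a_pos: "a > 0" and chart_norm: "x \<in> V \<Longrightarrow> norm (\<theta> x) \<le> a"
    and chart_minus: "x \<in> V \<Longrightarrow> \<theta> (- x) = - \<theta> x"
    and chart_add: "\<lbrakk>x \<in> V; y \<in> V; norm (\<theta> x + \<theta> y) \<le> a\<rbrakk> \<Longrightarrow> x + y \<in> V \<and> \<theta> (x + y) = \<theta> x + \<theta> y"
    and E_finite: "finite E" and chart_span: "\<theta> ` V \<subseteq> span E"
    and chart_bounded: "linear f \<Longrightarrow> \<exists>C. \<forall>x\<in>V. \<bar>f (\<theta> x)\<bar> \<le> C * norm (\<theta> x)"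
begin

lemma zero_in_V: "0 \<in> V" using zero_in_nbhd0[OF V_nbhd0] .

lemma chart_0: "\<theta> 0 = 0"
proof -
  have "2 *\<^sub>R \<theta> 0 = \<theta> 0 - (- \<theta> 0)" by (simp add: scaleR_2)
  also have "\<dots> = 0" using chart_minus[OF zero_in_V] by simp
  finally show ?thesis by simp
qed

lemma nbhd0_chart_small:
  assumes "d > 0" shows "nbhd0 {x \<in> V. norm (\<theta> x) < d}"
proof -
  have "openin (subtopology T V) {x \<in> topspace (subtopology T V). \<theta> x \<in> ball 0 d}"
    by (rule openin_continuous_map_preimage[OF chart_continuous]) simp
  then obtain W where W: "openin T W" "{x \<in> topspace (subtopology T V). \<theta> x \<in> ball 0 d} = W \<inter> V"
    unfolding openin_subtopology by blast
  have eq: "{x \<in> topspace (subtopology T V). \<theta> x \<in> ball 0 d} = {x \<in> V. norm (\<theta> x) < d}" by auto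
  have "0 \<in> {x \<in> V. norm (\<theta> x) < d}" using assms zero_in_V by (simp add: chart_0)
  then have "nbhd0 (W \<inter> V)" using W eq by (intro nbhd0_Int nbhd0_openin V_nbhd0) auto
  then show ?thesis using W eq by simp
qed

end

locale linear_chart = lc_chart T V \<theta> a E
  for T :: "'a::ab_group_add topology" and V and \<theta> :: "'a \<Rightarrow> 'v::real_normed_vector" and a E +
  fixes L :: "'v set"
  assumes L_subspace: "subspace L" and chart_image: "\<theta> ` V = L \<inter> cball 0 a"
begin

definition N :: "'a set" where "N = {x \<in> V. \<theta> x = 0}"

text \<open>An arbitrary section of the chart, meaningful on \<open>L \<inter> cball 0 a\<close>;
  two choices differ by an element of \<open>N\<close>.\<close>

definition lift :: "'v \<Rightarrow> 'a" where "lift y = (SOME v. v \<in> V \<and> \<theta> v = y)"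

text \<open>The exponential of \<open>y\<close>, computed as \<open>n\<close> times a lift of
  \<open>y / n\<close>. Modulo \<open>N\<close> it is independent of \<open>n\<close> once
  \<open>norm y \<le> real n * a\<close>.\<close>

definition expo :: "nat \<Rightarrow> 'v \<Rightarrow> 'a" where "expo n y = ntimes n (lift ((1 / real n) *\<^sub>R y))"

text \<open>The graph of the exponential map from \<open>L\<close> onto the open subgroup generated by \<open>V\<close>, modulo \<open>N\<close>.\<close>

definition rel :: "'a \<Rightarrow> 'v \<Rightarrow> bool" where
  "rel g y \<longleftrightarrow> y \<in> L \<and> (\<exists>n\<ge>1. norm y \<le> real n * a \<and> g - expo n y \<in> N)"

section \<open>The exponential map of a linear chart\<close>

lemma chart_diff_in_N:
  assumes "v \<in> V" "w \<in> V" "\<theta> v = \<theta> w" shows "v - w \<in> N"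
  using chart_add[OF assms(1) V_minus[OF assms(2)]] assms chart_minus[OF assms(2)] a_pos
  by (simp add: N_def)

lemma N_diff: "x \<in> N \<Longrightarrow> y \<in> N \<Longrightarrow> x - y \<in> N"
  using chart_diff_in_N by (simp add: N_def)

lemma N_0: "0 \<in> N" using zero_in_V chart_0 by (simp add: N_def)

lemma N_add: "x \<in> N \<Longrightarrow> y \<in> N \<Longrightarrow> x + y \<in> N"
  using N_diff[of x "0 - y"] N_diff[OF N_0, of y] by simp

lemma N_ntimes: "x \<in> N \<Longrightarrow> ntimes n x \<in> N"
  by (induction n) (auto intro: N_add N_0)

lemma chart_ntimes:
  assumes "v \<in> V" "norm (real n *\<^sub>R \<theta> v) \<le> a"
  shows "ntimes n v \<in> V \<and> \<theta> (ntimes n v) = real n *\<^sub>R \<theta> v"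
  using assms(2)
proof (induction n)
  case (Suc n)
  have "norm (real n *\<^sub>R \<theta> v) \<le> norm (real (Suc n) *\<^sub>R \<theta> v)" by (simp add: mult_right_mono)
  then have "ntimes n v \<in> V \<and> \<theta> (ntimes n v) = real n *\<^sub>R \<theta> v" using Suc by simp
  then show ?case using chart_add[OF assms(1), of "ntimes n v"] Suc.prems by (simp add: algebra_simps)
qed (simp add: zero_in_V chart_0)

lemma lift:
  assumes "y \<in> L" "norm y \<le> a" shows "lift y \<in> V" "\<theta> (lift y) = y"
proof -
  have "y \<in> \<theta> ` V" using assms by (simp add: chart_image)
  then have "\<exists>v. v \<in> V \<and> \<theta> v = y" by blast
  then have "lift y \<in> V \<and> \<theta> (lift y) = y" unfolding lift_def by (rule someI_ex)
  then show "lift y \<in> V" "\<theta> (lift y) = y" by simp_all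
qed

lemma L_scale: "y \<in> L \<Longrightarrow> c *\<^sub>R y \<in> L"
  using L_subspace by (simp add: subspace_scale)

lemma norm_part: "n \<ge> 1 \<Longrightarrow> norm y \<le> real n * a \<Longrightarrow> norm ((1 / real n) *\<^sub>R y) \<le> a"
  by (simp add: field_simps)

text \<open>With \<open>z = y / n\<close> and \<open>z' = y / (n k)\<close>, both
  \<open>lift z\<close> and \<open>k\<close> times \<open>lift z'\<close> have chart value
  \<open>z\<close>, so they differ by an element of \<open>N\<close>.\<close>

lemma expo_mult:
  assumes y: "y \<in> L" and n: "n \<ge> 1" "norm y \<le> real n * a" and k: "k \<ge> 1"
  shows "expo n y - expo (n * k) y \<in> N"
proof -
  define z where "z = (1 / real n) *\<^sub>R y"
  define z' where "z' = (1 / real (n * k)) *\<^sub>R y"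
  have kz': "real k *\<^sub>R z' = z" using k by (simp add: z_def z'_def)
  have z: "z \<in> L" "norm z \<le> a" unfolding z_def using L_scale y norm_part n by auto
  have "norm z' \<le> real k * norm z'" using mult_right_mono[of 1 "real k" "norm z'"] k by simp
  also have "\<dots> = norm z" using kz' by (metis norm_scaleR abs_of_nat)
  finally have z': "z' \<in> L" "norm z' \<le> a" using z(2) L_scale y by (auto simp: z'_def)
  have "norm (real k *\<^sub>R \<theta> (lift z')) \<le> a" using z kz' lift[OF z'] by simp
  from chart_ntimes[OF lift(1)[OF z'] this]
  have "ntimes k (lift z') \<in> V" "\<theta> (ntimes k (lift z')) = z" using lift(2)[OF z'] kz' by simp_all
  then have "lift z - ntimes k (lift z') \<in> N" using lift[OF z] by (intro chart_diff_in_N) auto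
  from N_ntimes[OF this, of n] show ?thesis
    unfolding expo_def z_def[symmetric] z'_def[symmetric] by (simp add: ntimes_diff ntimes_mult)
qed

text \<open>Both sides are compared with the common refinement \<open>n * m\<close>.\<close>

lemma expo_indep:
  assumes "y \<in> L" "n \<ge> 1" "norm y \<le> real n * a" "m \<ge> 1" "norm y \<le> real m * a"
  shows "expo n y - expo m y \<in> N"
  using N_diff[OF expo_mult[of y n m] expo_mult[of y m n]] assms by (simp add: mult.commute)

text \<open>\<open>n\<close> is large enough for both parts and their sum to fit into the chart,
  where \<open>chart_add\<close> applies.\<close>

lemma expo_add:
  assumes y: "y \<in> L" and z: "z \<in> L" and n: "n \<ge> 1" "norm y + norm z \<le> real n * a"
  shows "expo n (y + z) - (expo n y + expo n z) \<in> N"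
proof -
  define u where "u = (1 / real n) *\<^sub>R y"
  define w where "w = (1 / real n) *\<^sub>R z"
  have "norm y \<le> real n * a" "norm z \<le> real n * a" "norm (y + z) \<le> real n * a"
    using n(2) norm_ge_zero[of y] norm_ge_zero[of z] norm_triangle_ineq[of y z] by linarith+
  then have norms: "norm u \<le> a" "norm w \<le> a" "norm (u + w) \<le> a"
    unfolding u_def w_def scaleR_add_right[symmetric] using n(1) by (blast intro: norm_part)+
  have L: "u \<in> L" "w \<in> L" "u + w \<in> L"
    using y z L_scale L_subspace by (auto simp: u_def w_def subspace_add)
  have "lift u + lift w \<in> V \<and> \<theta> (lift u + lift w) = u + w"
    using chart_add[OF lift(1)[OF L(1) norms(1)] lift(1)[OF L(2) norms(2)]] lift(2) L norms by simp
  then have "lift (u + w) - (lift u + lift w) \<in> N"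
    using lift[OF L(3) norms(3)] by (intro chart_diff_in_N) auto
  from N_ntimes[OF this, of n] show ?thesis
    unfolding expo_def scaleR_add_right u_def[symmetric] w_def[symmetric]
    by (simp add: ntimes_diff ntimes_plus)
qed

lemma rel_iff:
  assumes "y \<in> L" "n \<ge> 1" "norm y \<le> real n * a"
  shows "rel g y \<longleftrightarrow> g - expo n y \<in> N"
proof
  assume "rel g y"
  then obtain m where m: "m \<ge> 1" "norm y \<le> real m * a" "g - expo m y \<in> N" unfolding rel_def by blast
  have "(g - expo m y) + (expo m y - expo n y) \<in> N"
    using N_add[OF m(3) expo_indep[OF assms(1) m(1,2) assms(2,3)]] .
  then show "g - expo n y \<in> N" by simp
next
  assume "g - expo n y \<in> N" then show "rel g y" using assms unfolding rel_def by blast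
qed

lemma ex_size:
  fixes r :: real
  obtains n :: nat where "n \<ge> 1" "r \<le> real n * a"
proof -
  obtain n :: nat where n: "r / a \<le> real n" using real_arch_simple by blast
  have "real n * a \<le> real (Suc n) * a" using a_pos by (intro mult_right_mono) auto
  moreover have "r \<le> real n * a" using n a_pos by (simp add: field_simps)
  ultimately show ?thesis using that[of "Suc n"] by linarith
qed

lemma rel_L: "rel g y \<Longrightarrow> y \<in> L" by (simp add: rel_def)

lemma rel_ex: "y \<in> L \<Longrightarrow> \<exists>g. rel g y"
  using rel_iff ex_size[of "norm y"] N_0 by (metis diff_self)

lemma rel_add:
  assumes "rel g y" "rel g' y'" shows "rel (g + g') (y + y')"
proof -
  have L: "y \<in> L" "y' \<in> L" "y + y' \<in> L" using assms L_subspace by (auto dest: rel_L intro: subspace_add)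
  obtain n where n: "n \<ge> 1" "norm y + norm y' \<le> real n * a" using ex_size by blast
  have norms: "norm y \<le> real n * a" "norm y' \<le> real n * a" "norm (y + y') \<le> real n * a"
    using n(2) norm_ge_zero[of y] norm_ge_zero[of y'] norm_triangle_ineq[of y y'] by linarith+
  have "g - expo n y \<in> N" "g' - expo n y' \<in> N" using assms rel_iff L n norms by auto
  then have "((g - expo n y) + (g' - expo n y')) - (expo n (y + y') - (expo n y + expo n y')) \<in> N"
    using expo_add[OF L(1,2) n] by (meson N_diff N_add)
  then have "(g + g') - expo n (y + y') \<in> N" by (simp add: algebra_simps)
  then show ?thesis using rel_iff L n norms by auto
qed

lemma rel_0_iff: "rel g 0 \<longleftrightarrow> g \<in> N"
proof -
  have L0: "0 \<in> L" using L_subspace by (rule subspace_0)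
  have "expo 1 0 \<in> N" using lift[OF L0] a_pos by (simp add: expo_def N_def)
  then have "g - expo 1 0 \<in> N \<longleftrightarrow> g \<in> N" using N_add[of "g - expo 1 0" "expo 1 0"] N_diff by auto
  then show ?thesis using rel_iff[OF L0, of 1 g] a_pos by simp
qed

lemma rel_cong_N: "rel g y \<Longrightarrow> g' - g \<in> N \<Longrightarrow> rel g' y"
  using rel_add[of g y "g' - g" 0] by (simp add: rel_0_iff)

lemma rel_uminus:
  assumes "rel g y" shows "rel (- g) (- y)"
proof -
  have "- y \<in> L" using assms L_subspace by (auto dest: rel_L intro: subspace_neg)
  then obtain g' where g': "rel g' (- y)" using rel_ex by blast
  have "g + g' \<in> N" using rel_add[OF assms g'] by (simp add: rel_0_iff)
  then have "- g - g' \<in> N" using N_diff[OF N_0, of "g + g'"] by (simp add: algebra_simps)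
  then show ?thesis using rel_cong_N[OF g'] by simp
qed

lemma rel_diff: "rel g y \<Longrightarrow> rel g' y' \<Longrightarrow> rel (g - g') (y - y')"
  using rel_add[OF _ rel_uminus] by fastforce

lemma rel_V:
  assumes "v \<in> V" shows "rel v (\<theta> v)"
proof -
  have L: "\<theta> v \<in> L" "norm (\<theta> v) \<le> a" using assms chart_image by auto
  then have "v - expo 1 (\<theta> v) \<in> N" using lift assms by (auto simp: expo_def intro: chart_diff_in_N)
  then show ?thesis using rel_iff[of "\<theta> v" 1] L by simp
qed

section \<open>The kernel of the exponential and characters induced by linear forms\<close>

lemma kernel_scale_int:
  assumes "rel 0 y" shows "rel 0 (real_of_int k *\<^sub>R y)"
proof -
  have nat: "rel 0 (real n *\<^sub>R y)" for n
  proof (induction n)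
    case (Suc n)
    then show ?case using rel_add[OF assms Suc] by (simp add: algebra_simps)
  qed (simp add: rel_0_iff N_0)
  show ?thesis
  proof (cases "k \<ge> 0")
    case True
    then show ?thesis using nat[of "nat k"] by simp
  next
    case False
    then show ?thesis using rel_uminus[OF nat[of "nat (- k)"]] by simp
  qed
qed

lemma kernel_sum:
  assumes "\<And>b. b \<in> B \<Longrightarrow> rel 0 (f b)" shows "rel 0 (\<Sum>b\<in>B. f b)"
  using assms
proof (induction B rule: infinite_finite_induct)
  case (insert b B)
  then show ?case using rel_add[of 0 "f b" 0 "sum f B"] by simp
qed (simp_all add: rel_0_iff N_0)

text \<open>Two vectors related to the same \<open>g\<close> differ by an element of the kernel,
  where \<open>f\<close> vanishes, so \<open>cis (f y)\<close> depends on \<open>g\<close>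
  alone.\<close>

lemma char_graph_rel:
  assumes f: "linear f" "\<And>y. rel 0 y \<Longrightarrow> f y = 0"
  shows "char_graph {(g, cis (f y)) | g y. rel g y}"
  unfolding char_graph_def
proof (intro conjI allI impI)
  have "rel 0 0" by (simp add: rel_0_iff N_0)
  then show "(0, 1) \<in> {(g, cis (f y)) | g y. rel g y}" using linear_0[OF f(1)] by force
next
  fix x c y d
  assume "(x, c) \<in> {(g, cis (f y)) | g y. rel g y}" "(y, d) \<in> {(g, cis (f y)) | g y. rel g y}"
  then obtain u w where "rel x u" "c = cis (f u)" "rel y w" "d = cis (f w)" by blast
  moreover from this have "c / d = cis (f (u - w))" by (simp add: cis_divide linear_diff[OF f(1)])
  ultimately show "(x - y, c / d) \<in> {(g, cis (f y)) | g y. rel g y}" using rel_diff by blast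
next
  fix c assume "(0, c) \<in> {(g, cis (f y)) | g y. rel g y}"
  then show "c = 1" using f(2) by auto
qed auto

text \<open>The bound is a pointwise closed condition inside a compact product of circles, and it
  forces continuity at 0.\<close>

lemma equicontinuous_K_family:
  "{h. circle_hom h \<and> (\<forall>v\<in>V. dist (h v) 1 \<le> C * norm (\<theta> v))} \<in> K_family T"
  (is "?K \<in> _")
  unfolding K_family_iff
proof
  have "?K = {h. \<forall>x. norm (h x) = 1} \<inter>
      ({h. circle_hom h} \<inter> (\<Inter>v\<in>V. {h. dist (h v) 1 \<le> C * norm (\<theta> v)}))"
    by (auto simp: circle_hom_def)
  also have "compact \<dots>"
    by (intro compact_Int_closed compact_circle_functions closed_Int closed_circle_homs closed_INT
        ballI closed_dist_eval_le)
  finally show "compact ?K" .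
  show "?K \<subseteq> dual_group T"
  proof
    fix h assume h: "h \<in> ?K"
    show "h \<in> dual_group T"
    proof (rule dual_groupI)
      fix e :: real assume e: "e > 0"
      define d where "d = e / (\<bar>C\<bar> + 1)"
      have d: "d > 0" using e by (simp add: d_def)
      have "dist (h x) 1 < e" if x: "x \<in> V" "norm (\<theta> x) < d" for x
      proof -
        have "dist (h x) 1 \<le> C * norm (\<theta> x)" using h x by blast
        also have "\<dots> \<le> (\<bar>C\<bar> + 1) * norm (\<theta> x)" by (intro mult_right_mono) auto
        also have "\<dots> < (\<bar>C\<bar> + 1) * d" using x by (intro mult_strict_left_mono) auto
        finally show ?thesis by (simp add: d_def)
      qed
      then show "nbhd0 {x. dist (h x) 1 < e}"
        by (intro nbhd0_mono[OF nbhd0_chart_small[OF d]]) auto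
    qed (use h in simp)
  qed
qed

text \<open>A small positive multiple of any \<open>y \<in> L\<close> is a chart value.\<close>

lemma L_span: "L \<subseteq> span E"
proof
  fix y assume y: "y \<in> L"
  define c where "c = a / (norm y + 1)"
  have n1: "norm y + 1 > 0" by (meson add_nonneg_pos norm_ge_zero zero_less_one)
  have c: "c > 0" using a_pos n1 by (simp add: c_def)
  have "c * norm y \<le> c * (norm y + 1)" using c by simp
  also have "\<dots> = a" using n1 by (simp add: c_def)
  finally have "c *\<^sub>R y \<in> \<theta> ` V" using L_scale[OF y] c by (simp add: chart_image)
  then have "(1 / c) *\<^sub>R c *\<^sub>R y \<in> span E" using chart_span span_scale by blast
  then show "y \<in> span E" using c by simp
qed

lemma compact_ball_exists:
  "\<exists>K\<in>K_family T. \<exists>C. compactin T C \<and> {x. \<forall>h\<in>K. dist (h x) 1 < 1/2} \<subseteq> C"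
proof -
  define \<Lambda> where "\<Lambda> = {y. rel 0 y}"
  obtain B where B: "B \<subseteq> \<Lambda>" "independent B" "\<Lambda> \<subseteq> span B" using maximal_independent_subset by blast
  have "B \<subseteq> L" using B(1) rel_L by (auto simp: \<Lambda>_def)
  \<comment> \<open>\<open>B\<close> is a basis of the span of the kernel and \<open>B'\<close>
    completes it to a basis of \<open>L\<close>; the forms \<open>f b\<close> below are its
    coordinates.\<close>
  then obtain B' where B': "B \<subseteq> B'" "B' \<subseteq> L" "independent B'" "L \<subseteq> span B'"
    using maximal_independent_subset_extend[OF _ B(2)] by metis
  have B'fin: "finite B'"
    using independent_span_bound[OF E_finite B'(3)] B'(2) L_span by auto
  have "\<exists>f. linear f \<and> (\<forall>b'\<in>B'. f b' = (if b' = b then 1 else 0 :: real))" for b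
    using linear_independent_extend[OF B'(3), of "\<lambda>b'. if b' = b then 1 else 0 :: real"] by blast
  then obtain f where f: "\<And>b. linear (f b)" and fB: "\<And>b b'. b' \<in> B' \<Longrightarrow> f b b' = (if b' = b then 1 else 0 :: real)"
    by metis
  have expand: "y = (\<Sum>b\<in>B'. f b y *\<^sub>R b)" if "y \<in> L" for y
  proof -
    have "linear (\<lambda>y. f b y *\<^sub>R b)" for b
      by (rule linearI) (simp_all add: linear_add[OF f] linear_scale[OF f] scaleR_left_distrib)
    then have "linear (\<lambda>y. \<Sum>b\<in>B'. f b y *\<^sub>R b)"
      by (intro linear_compose_sum ballI)
    then have "(\<lambda>y. y) y = (\<lambda>y. \<Sum>b\<in>B'. f b y *\<^sub>R b) y"
    proof (rule linear_eq_on[OF linear_id[unfolded id_def]])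
      show "y \<in> span B'" using that B'(4) by blast
      fix b assume b: "b \<in> B'"
      have "(\<Sum>c\<in>B'. f c b *\<^sub>R c) = (\<Sum>c\<in>B'. if b = c then c else 0)"
        by (rule sum.cong) (auto simp: fB b)
      then show "b = (\<Sum>c\<in>B'. f c b *\<^sub>R c)" using b B'fin by simp
    qed
    then show ?thesis by simp
  qed
  have f_kernel: "f b y = 0" if b: "b \<notin> B" and y: "rel 0 y" for b y
  proof (rule linear_eq_0_on_span[OF f[of b]])
    show "y \<in> span B" using B(3) y by (auto simp: \<Lambda>_def)
    show "f b x = 0" if "x \<in> B" for x using fB[of x b] that b B'(1) by auto
  qed
  have "\<exists>C. \<forall>x\<in>V. \<bar>f b (\<theta> x)\<bar> \<le> C * norm (\<theta> x)" for b using chart_bounded[OF f] .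
  then obtain c where c: "\<And>b x. x \<in> V \<Longrightarrow> \<bar>f b (\<theta> x)\<bar> \<le> c b * norm (\<theta> x)" by metis
  \<comment> \<open>One constant for all coordinate forms; the absolute values guard against
    negative \<open>c b\<close>.\<close>
  define C where "C = (\<Sum>b\<in>B'. \<bar>c b\<bar>)"
  have C: "\<bar>f b (\<theta> x)\<bar> \<le> C * norm (\<theta> x)" if b: "b \<in> B'" and x: "x \<in> V" for b x
  proof -
    have "\<bar>f b (\<theta> x)\<bar> \<le> c b * norm (\<theta> x)" using c x .
    also have "\<dots> \<le> C * norm (\<theta> x)"
      using member_le_sum[OF b _ B'fin, of "\<lambda>b. \<bar>c b\<bar>"] by (intro mult_right_mono) (auto simp: C_def)
    finally show ?thesis .
  qed
  have C0: "C \<ge> 0" by (simp add: C_def sum_nonneg)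
  define K where "K = {h. circle_hom h \<and> (\<forall>v\<in>V. dist (h v) 1 \<le> C * norm (\<theta> v))}"
  define M where "M = (\<Sum>b\<in>B'. norm b)"
  obtain m where m: "m \<ge> 1" "M \<le> real m * a" using ex_size by blast
  \<comment> \<open>By the definition of \<open>expo\<close>, this contains every \<open>x\<close>
    with \<open>rel x q\<close> for some \<open>q\<close> with
    \<open>norm q \<le> real m * a\<close>.\<close>
  define Cset where "Cset = (\<lambda>(v, u). ntimes m v + u) ` (V \<times> N)"
  have "compactin T Cset"
    unfolding Cset_def
  proof (rule image_compactin)
    have "closedin (subtopology T V) {x \<in> topspace (subtopology T V). \<theta> x \<in> {0}}"
      by (rule closedin_continuous_map_preimage[OF chart_continuous]) simp
    moreover have "{x \<in> topspace (subtopology T V). \<theta> x \<in> {0}} = N" by (auto simp: N_def)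
    ultimately have "compactin (subtopology T V) N"
      using V_compact closedin_compact_space[of "subtopology T V"] by (simp add: compact_space_subtopology)
    then have "compactin T N" by (simp add: compactin_subtopology)
    then show "compactin (prod_topology T T) (V \<times> N)" using V_compact by (simp add: compactin_Times)
    have ntimes_cont: "continuous_map (prod_topology T T) T (\<lambda>x. ntimes k (fst x))" for k
      by (induction k) (auto intro!: continuous_map_plus continuous_map_fst)
    show "continuous_map (prod_topology T T) T (\<lambda>(v, u). ntimes m v + u)"
      unfolding case_prod_beta by (intro continuous_map_plus ntimes_cont continuous_map_snd)
  qed
  moreover have "{x. \<forall>h\<in>K. dist (h x) 1 < 1/2} \<subseteq> Cset"
  proof
    fix x assume "x \<in> {x. \<forall>h\<in>K. dist (h x) 1 < 1/2}"
    then have small: "dist (h x) 1 < 1/2" if "h \<in> K" for h using that by blast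
    \<comment> \<open>Otherwise some character trivial on \<open>V\<close> is nontrivial at
      \<open>x\<close>. A suitable power moves \<open>x\<close> further than 1/2 from 1, yet is
      still trivial on \<open>V\<close> and so belongs to \<open>K\<close>.\<close>
    have "\<exists>y. rel x y"
    proof (rule ccontr)
      assume "\<nexists>y. rel x y"
      define R where "R = {(g, cis ((\<lambda>_. 0) y)) | g y. rel g y}"
      have "char_graph R" unfolding R_def by (rule char_graph_rel) (simp_all add: linear_zero)
      moreover have "x \<notin> Domain R" using \<open>\<nexists>y. rel x y\<close> by (auto simp: R_def)
      ultimately obtain h where h: "circle_hom h" "\<And>x a. (x, a) \<in> R \<Longrightarrow> h x = a" "h x \<noteq> 1"
        by (rule char_graph_extend_separating) blast
      obtain n where n: "dist (h x ^ n) 1 > 1/2" using circle_power_away[OF h(3)] by blast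
      have "h v = 1" if "v \<in> V" for v using h(2)[of v 1] rel_V[OF that] by (auto simp: R_def)
      then have "(\<lambda>x. h x ^ n) \<in> K" using circle_hom_power[OF h(1)] C0 by (simp add: K_def)
      from small[OF this] show False using n by simp
    qed
    then obtain y where y: "rel x y" by blast
    have f_small: "\<bar>f b y\<bar> \<le> 1" if b: "b \<in> B'" "b \<notin> B" for b
    proof (rule ccontr)
      assume gt: "\<not> \<bar>f b y\<bar> \<le> 1"
      \<comment> \<open>Normalized so that the induced character takes the value
        \<open>cis 1\<close> at \<open>x\<close>, too far from 1 since
        \<open>sin 1 \<ge> 1/2\<close>; \<open>\<bar>s\<bar> \<le> 1\<close> preserves the bound by
        \<open>C\<close>.\<close>
      define s where "s = 1 / f b y"
      have s: "\<bar>s\<bar> \<le> 1" "s * f b y = 1" using gt by (auto simp: s_def field_simps)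
      have "char_graph {(g, cis (s * f b y)) | g y. rel g y}"
      proof (rule char_graph_rel)
        show "linear (\<lambda>y. s * f b y)" using linear_compose_scale_right[OF f[of b], of s] by simp
      qed (simp add: f_kernel b)
      from char_graph_extend[OF this] obtain h where h: "circle_hom h"
        "\<And>g c. (g, c) \<in> {(g, cis (s * f b y)) | g y. rel g y} \<Longrightarrow> h g = c" by blast
      have hv: "h g = cis (s * f b z)" if "rel g z" for g z using that by (intro h(2)) blast
      have "dist (h v) 1 \<le> C * norm (\<theta> v)" if v: "v \<in> V" for v
      proof -
        have "dist (h v) 1 \<le> \<bar>s * f b (\<theta> v)\<bar>" using hv[OF rel_V[OF v]] norm_cis_diff_1 by simp
        also have "\<dots> = \<bar>s\<bar> * \<bar>f b (\<theta> v)\<bar>" by (rule abs_mult)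
        also have "\<dots> \<le> 1 * (C * norm (\<theta> v))" using s(1) C[OF b(1) v] by (intro mult_mono) auto
        finally show ?thesis by simp
      qed
      then have "h \<in> K" using h(1) by (simp add: K_def)
      then have "dist (cis 1) 1 < 1/2" using small[of h] hv[OF y] s(2) by (simp only:)
      then have "\<bar>Re (cis 1 - 1)\<bar> < 1/2" "\<bar>Im (cis 1 - 1)\<bar> < 1/2"
        using abs_Re_le_cmod[of "cis 1 - 1"] abs_Im_le_cmod[of "cis 1 - 1"] by (simp_all only: dist_norm)
      moreover have "sin 1 \<ge> (1/2 :: real)"
      proof -
        have "sin (pi / 6) \<le> sin 1" using pi_less_4 pi_gt3 by (intro sin_monotone_2pi_le) auto
        then show ?thesis by (simp add: sin_30)
      qed
      ultimately show False by simp
    qed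
    \<comment> \<open>An integer combination of kernel vectors, hence in the kernel. Subtracting it
      keeps the relation to \<open>x\<close> and brings the coordinates along \<open>B\<close> into
      the unit interval.\<close>
    define p where "p = (\<Sum>b\<in>B. real_of_int \<lfloor>f b y\<rfloor> *\<^sub>R b)"
    have p: "rel 0 p" unfolding p_def using B(1) by (intro kernel_sum kernel_scale_int) (auto simp: \<Lambda>_def)
    define q where "q = y - p"
    have q: "rel x q" using rel_diff[OF y p] by (simp add: q_def)
    have Bfin: "finite B" using B'(1) B'fin by (rule finite_subset)
    define t where "t b = (if b \<in> B then f b y - real_of_int \<lfloor>f b y\<rfloor> else f b y)" for b
    have "p = (\<Sum>b\<in>B'. (if b \<in> B then real_of_int \<lfloor>f b y\<rfloor> else 0) *\<^sub>R b)"
      unfolding p_def using B'(1) B'fin by (intro sum.mono_neutral_cong_left) auto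
    then have "q = (\<Sum>b\<in>B'. t b *\<^sub>R b)"
      unfolding q_def t_def
      by (subst expand[OF rel_L[OF y]], simp add: sum_subtractf[symmetric] flip: scaleR_diff_left)
        (intro sum.cong, auto)
    then have "norm q \<le> (\<Sum>b\<in>B'. norm (t b *\<^sub>R b))" by (simp only: norm_sum)
    also have "\<dots> \<le> M" unfolding M_def
    proof (rule sum_mono)
      fix b assume b: "b \<in> B'"
      have "\<bar>t b\<bar> \<le> 1"
      proof (cases "b \<in> B")
        case True then show ?thesis unfolding t_def by (simp) linarith
      next
        case False then show ?thesis using f_small[OF b] by (simp add: t_def)
      qed
      then show "norm (t b *\<^sub>R b) \<le> norm b" using mult_right_mono[of "\<bar>t b\<bar>" 1 "norm b"] by simp
    qed
    finally have qM: "norm q \<le> real m * a" using m by simp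
    have "x - expo m q \<in> N" using rel_iff[OF rel_L[OF q] m(1) qM] q by simp
    moreover have "lift ((1 / real m) *\<^sub>R q) \<in> V"
      using lift L_scale rel_L[OF q] norm_part[OF m(1) qM] by blast
    moreover have "x = (\<lambda>(v, u). ntimes m v + u) (lift ((1 / real m) *\<^sub>R q), x - expo m q)"
      by (simp add: expo_def)
    ultimately show "x \<in> Cset" unfolding Cset_def by blast
  qed
  moreover have "K \<in> K_family T" unfolding K_def by (rule equicontinuous_K_family)
  ultimately show ?thesis by blast
qed

end

context lc_chart
begin

text \<open>The chart image is a compact local subgroup, hence linear near 0; the new chart keeps
  only values of norm at most \<open>b\<close>.\<close>

lemma linear_subchart:
  obtains W b L where "linear_chart T W \<theta> b E L"
proof -
  have "compactin (subtopology T V) V" using V_compact by (simp add: compactin_subtopology)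
  from image_compactin[OF this chart_continuous] have comp: "compact (\<theta> ` V)" by simp
  have "\<exists>L b. subspace L \<and> 0 < b \<and> b \<le> a \<and> \<theta> ` V \<inter> cball 0 b = L \<inter> cball 0 b"
  proof (rule local_subgroup_linear[OF comp _ _ a_pos])
    show "0 \<in> \<theta> ` V" using zero_in_V chart_0 by force
    show "- s \<in> \<theta> ` V" if s: "s \<in> \<theta> ` V" for s
    proof -
      obtain x where x: "x \<in> V" "s = \<theta> x" using s by blast
      then have "- s = \<theta> (- x)" by (simp add: chart_minus)
      then show ?thesis using V_minus[OF x(1)] by blast
    qed
    show "\<theta> ` V \<subseteq> cball 0 a" using chart_norm by auto
    show "s + t \<in> \<theta> ` V" if s: "s \<in> \<theta> ` V" "t \<in> \<theta> ` V" "norm (s + t) \<le> a" for s t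
    proof -
      obtain x y where "x \<in> V" "s = \<theta> x" "y \<in> V" "t = \<theta> y" using s by blast
      then have "x + y \<in> V" "s + t = \<theta> (x + y)" using chart_add s(3) by auto
      then show ?thesis by blast
    qed
  qed blast
  then obtain L b where L: "subspace L" "0 < b" "b \<le> a" "\<theta> ` V \<inter> cball 0 b = L \<inter> cball 0 b" by blast
  define W where "W = {x \<in> V. norm (\<theta> x) \<le> b}"
  have WV: "W \<subseteq> V" by (auto simp: W_def)
  have "linear_chart T W \<theta> b E L"
  proof
    have "closedin (subtopology T V) {x \<in> topspace (subtopology T V). \<theta> x \<in> cball 0 b}"
      by (rule closedin_continuous_map_preimage[OF chart_continuous]) simp
    moreover have "{x \<in> topspace (subtopology T V). \<theta> x \<in> cball 0 b} = W" by (auto simp: W_def)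
    ultimately have "compactin (subtopology T V) W"
      using V_compact closedin_compact_space[of "subtopology T V"] by (simp add: compact_space_subtopology)
    then show "compactin T W" by (simp add: compactin_subtopology)
    show "nbhd0 W" by (rule nbhd0_mono[OF nbhd0_chart_small[OF L(2)]]) (auto simp: W_def)
    show "continuous_map (subtopology T W) euclidean \<theta>"
      using continuous_map_from_subtopology_mono[OF chart_continuous WV] .
    show "\<theta> ` W = L \<inter> cball 0 b" unfolding L(4)[symmetric] by (auto simp: W_def)
    show "x + y \<in> W \<and> \<theta> (x + y) = \<theta> x + \<theta> y" if "x \<in> W" "y \<in> W" "norm (\<theta> x + \<theta> y) \<le> b" for x y
      using chart_add[of x y] that L(3) by (auto simp: W_def)
    show "\<exists>C. \<forall>x\<in>W. \<bar>f (\<theta> x)\<bar> \<le> C * norm (\<theta> x)" if "linear f" for f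
      using chart_bounded[OF that] WV by blast
    show "\<theta> ` W \<subseteq> span E" using chart_span WV by blast
  qed (use L V_minus chart_minus E_finite in \<open>auto simp: W_def\<close>)
  then show ?thesis using that by blast
qed

end

section \<open>Local compactness of the topology of uniform convergence\<close>

definition unit_vec :: "nat \<Rightarrow> (nat, real) bcontfun" where
  "unit_vec i = Bcontfun (\<lambda>j. if j = i then 1 else 0)"

text \<open>The coordinate spaces of all finite dimensions sit in the single normed space of bounded
  sequences, because the dimension depends on the group and cannot be a type.\<close>

definition coord_vec :: "nat \<Rightarrow> (nat \<Rightarrow> real) \<Rightarrow> (nat, real) bcontfun" where
  "coord_vec m c = (\<Sum>i<m. c i *\<^sub>R unit_vec i)"

lemma apply_unit_vec: "apply_bcontfun (unit_vec i) j = (if j = i then 1 else 0)"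
proof -
  have "(\<lambda>j::nat. if j = i then 1 else 0 :: real) \<in> bcontfun"
    by (rule bcontfun_normI[of _ 1]) (auto intro: continuous_on_discrete)
  then show ?thesis by (simp add: unit_vec_def Bcontfun_inverse)
qed

lemma apply_coord_vec: "apply_bcontfun (coord_vec m c) j = (if j < m then c j else 0)"
  by (induction m) (auto simp: coord_vec_def apply_unit_vec less_Suc_eq plus_bcontfun.rep_eq scaleR_bcontfun.rep_eq)

lemma norm_coord_vec_le_iff:
  assumes "a \<ge> 0" shows "norm (coord_vec m c) \<le> a \<longleftrightarrow> (\<forall>i<m. \<bar>c i\<bar> \<le> a)"
proof
  assume *: "norm (coord_vec m c) \<le> a"
  show "\<forall>i<m. \<bar>c i\<bar> \<le> a"
  proof (intro allI impI)
    fix i assume "i < m"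
    then show "\<bar>c i\<bar> \<le> a" using norm_bounded[of "coord_vec m c" i] * by (simp add: apply_coord_vec)
  qed
next
  assume "\<forall>i<m. \<bar>c i\<bar> \<le> a"
  then show "norm (coord_vec m c) \<le> a" using assms by (intro norm_bound) (auto simp: apply_coord_vec)
qed

lemma coord_vec_add: "coord_vec m c + coord_vec m d = coord_vec m (\<lambda>i. c i + d i)"
  by (simp add: coord_vec_def scaleR_left_distrib sum.distrib)

lemma coord_vec_uminus: "- coord_vec m c = coord_vec m (\<lambda>i. - c i)"
  by (simp add: coord_vec_def sum_negf)

lemma coord_vec_cong: "(\<And>i. i < m \<Longrightarrow> c i = d i) \<Longrightarrow> coord_vec m c = coord_vec m d"
  by (simp add: coord_vec_def)

text \<open>Each coordinate is bounded by the supremum norm. This supplies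
  \<open>chart_bounded\<close>.\<close>

lemma coord_vec_linear_bound:
  fixes f :: "_ \<Rightarrow> real"
  assumes "linear f"
  shows "\<bar>f (coord_vec m c)\<bar> \<le> (\<Sum>i<m. \<bar>f (unit_vec i)\<bar>) * norm (coord_vec m c)"
proof -
  have "\<bar>c i\<bar> \<le> norm (coord_vec m c)" if "i < m" for i
    using that norm_coord_vec_le_iff[of "norm (coord_vec m c)" m c] by simp
  then have "(\<Sum>i<m. \<bar>c i * f (unit_vec i)\<bar>) \<le> (\<Sum>i<m. \<bar>f (unit_vec i)\<bar> * norm (coord_vec m c))"
    by (intro sum_mono) (simp add: abs_mult mult.commute[of "\<bar>c _\<bar>"] mult_left_mono)
  moreover have "f (coord_vec m c) = (\<Sum>i<m. c i * f (unit_vec i))"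
    by (simp add: coord_vec_def linear_sum[OF assms] linear_scale[OF assms])
  ultimately show ?thesis
    using order_trans[OF sum_abs[of "\<lambda>i. c i * f (unit_vec i)" "{..<m}"]]
    by (simp only: sum_distrib_right)
qed

section \<open>Arguments of complex numbers on the unit circle\<close>

lemma cis_Arg_unit: "norm z = 1 \<Longrightarrow> cis (Arg z) = z"
  using cis_Arg[of z] by (cases "z = 0") (auto simp: sgn_div_norm)

lemma Arg_cis_small: "\<bar>t\<bar> \<le> 1 \<Longrightarrow> Arg (cis t) = t"
  using pi_gt3 by (intro Arg_cis) auto

text \<open>Turns a bound on \<open>Arg\<close> into membership in a compact arc, so that it becomes
  a closed condition despite the jump of \<open>Arg\<close>.\<close>

lemma cis_image_iff:
  assumes "a \<le> 1" shows "z \<in> cis ` {-a..a} \<longleftrightarrow> norm z = 1 \<and> \<bar>Arg z\<bar> \<le> a"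
proof
  assume "z \<in> cis ` {-a..a}"
  then show "norm z = 1 \<and> \<bar>Arg z\<bar> \<le> a" using assms by (auto simp: Arg_cis_small)
next
  assume "norm z = 1 \<and> \<bar>Arg z\<bar> \<le> a"
  then show "z \<in> cis ` {-a..a}" using cis_Arg_unit[of z] by (intro image_eqI[of _ _ "Arg z"]) auto
qed

lemma Arg_mult_small:
  assumes "norm z = 1" "norm w = 1" "\<bar>Arg z + Arg w\<bar> \<le> 1"
  shows "Arg (z * w) = Arg z + Arg w"
  using Arg_cis_small[OF assms(3)] cis_Arg_unit assms(1,2) by (simp flip: cis_mult)

lemma Arg_inverse_small:
  assumes "norm z = 1" "\<bar>Arg z\<bar> \<le> 1" shows "Arg (1 / z) = - Arg z"
proof -
  have "1 / z = cis (- Arg z)"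
    using cis_Arg_unit[OF assms(1)] cis_divide[of 0 "Arg z"] by simp
  then show ?thesis using Arg_cis_small[of "- Arg z"] assms(2) by simp
qed

lemma dist_1_le_Arg: "norm z = 1 \<Longrightarrow> dist z 1 \<le> \<bar>Arg z\<bar>"
  using norm_cis_diff_1[of "Arg z"] by (simp add: cis_Arg_unit)

context lc_group
begin

text \<open>By compactness finitely many characters keep the part of \<open>V0 + V0\<close> outside
  \<open>O0\<close> away from the value 1; sums with small arguments therefore fall back into
  \<open>V0\<close>.\<close>

lemma chart_exists:
  assumes sep: "\<And>x. x \<noteq> 0 \<Longrightarrow> \<exists>h\<in>dual_group T. h x \<noteq> 1"
  obtains V and \<theta> :: "'a \<Rightarrow> (nat, real) bcontfun" and a E where "lc_chart T V \<theta> a E"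
proof -
  have "nbhd0 UNIV" by (rule nbhd0_openin) (use openin_topspace[of T] in simp_all)
  then obtain V0 where V0: "compactin T V0" "nbhd0 V0" "\<And>x. x \<in> V0 \<Longrightarrow> - x \<in> V0"
    using compact_nbhd0 by metis
  obtain O0 where O0: "openin T O0" "0 \<in> O0" "O0 \<subseteq> V0" using V0(2) unfolding nbhd0_def by blast
  define Q where "Q = (\<lambda>p. fst p + snd p) ` (V0 \<times> V0)"
  have "compactin T Q" unfolding Q_def
    by (rule image_compactin[of "prod_topology T T"])
      (use V0 in \<open>auto simp: compactin_Times intro!: continuous_map_plus continuous_map_fst continuous_map_snd\<close>)
  then have Qc: "compactin T (Q - O0)"
    using compactin_imp_closedin[OF Hausdorff] O0(1) by (meson Diff_subset closed_compactin closedin_diff)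
  define W where "W p = {x. dist (fst p x) 1 > snd p}" for p :: "('a \<Rightarrow> complex) \<times> real"
  define I where "I = dual_group T \<times> {0 :: real<..}"
  have "openin T U" if "U \<in> W ` I" for U
  proof -
    obtain h d where U: "h \<in> dual_group T" "U = W (h, d)" using \<open>U \<in> W ` I\<close> by (auto simp: I_def)
    have "openin T {x \<in> topspace T. h x \<in> - cball 1 d}"
      using U(1) by (intro openin_continuous_map_preimage[of T euclidean]) (auto simp: dual_group_iff)
    then show ?thesis by (simp add: U(2) W_def dist_commute not_le)
  qed
  moreover have "Q - O0 \<subseteq> \<Union>(W ` I)"
  proof
    fix x assume "x \<in> Q - O0"
    then have "x \<noteq> 0" using O0(2) by blast
    then obtain h where h: "h \<in> dual_group T" "h x \<noteq> 1" using sep by blast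
    then have "x \<in> W (h, dist (h x) 1 / 2)" "(h, dist (h x) 1 / 2) \<in> I" by (simp_all add: W_def I_def)
    then show "x \<in> \<Union>(W ` I)" by blast
  qed
  ultimately obtain \<F> where "finite \<F>" "\<F> \<subseteq> W ` I" "Q - O0 \<subseteq> \<Union>\<F>"
    using Qc unfolding compactin_def by meson
  then obtain F where F: "F \<subseteq> I" "finite F" "Q - O0 \<subseteq> \<Union>(W ` F)" using finite_subset_image by metis
  \<comment> \<open>Below every threshold, so arguments bounded by \<open>a\<close> exclude each
    \<open>W p\<close>; at most 1, so that adding arguments does not wrap around.\<close>
  define a where "a = Min (insert 1 (snd ` F))"
  have a: "a \<le> 1" "\<And>p. p \<in> F \<Longrightarrow> a \<le> snd p" using F(2) by (auto simp: a_def)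
  have a_pos: "a > 0" using F(1,2) by (auto simp: a_def I_def)
  define m where "m = card F"
  obtain g where "bij_betw g {0..<m} F" using ex_bij_betw_nat_finite[OF F(2)] by (auto simp: m_def)
  then have g: "g ` {..<m} = F" by (simp add: bij_betw_def atLeast0LessThan)
  define X where "X i = fst (g i)" for i
  have X: "X i \<in> dual_group T" if "i < m" for i using that g F(1) by (auto simp: X_def I_def)
  have Xh: "circle_hom (X i)" "continuous_map T euclidean (X i)" if "i < m" for i
    using X[OF that] by (simp_all add: dual_group_iff)
  have X1: "norm (X i x) = 1" if "i < m" for i x using Xh(1)[OF that] by (simp add: circle_hom_def)
  define V where "V = {x \<in> V0. \<forall>i<m. \<bar>Arg (X i x)\<bar> \<le> a}"
  define \<theta> where "\<theta> x = coord_vec m (\<lambda>i. Arg (X i x))" for x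
  have "lc_chart T V \<theta> a (unit_vec ` {..<m})"
  proof
    have "openin T (\<Union>i\<in>{..<m}. {x \<in> topspace T. X i x \<in> - (cis ` {-a..a})})"
    proof (intro openin_Union ballI)
      fix U assume "U \<in> (\<lambda>i. {x \<in> topspace T. X i x \<in> - (cis ` {-a..a})}) ` {..<m}"
      then obtain i where i: "i < m" "U = {x \<in> topspace T. X i x \<in> - (cis ` {-a..a})}" by blast
      have "compact (cis ` {-a..a})" by (intro compact_continuous_image continuous_intros compact_Icc)
      then have "open (- (cis ` {-a..a}))" by (intro open_Compl compact_imp_closed)
      then show "openin T U"
        unfolding i(2) by (intro openin_continuous_map_preimage[OF Xh(2)[OF i(1)]]) simp
    qed
    then have "compactin T (V0 - (\<Union>i\<in>{..<m}. {x \<in> topspace T. X i x \<in> - (cis ` {-a..a})}))"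
      using V0(1) compactin_imp_closedin[OF Hausdorff V0(1)]
      by (meson Diff_subset closed_compactin closedin_diff)
    moreover have "V0 - (\<Union>i\<in>{..<m}. {x \<in> topspace T. X i x \<in> - (cis ` {-a..a})}) = V"
      using X1 by (auto simp: V_def cis_image_iff[OF a(1)])
    ultimately show "compactin T V" by simp
  next
    have "isCont Arg 1" by (rule continuous_at_Arg) simp
    then obtain d where d: "d > 0" "\<And>z. dist z 1 < d \<Longrightarrow> \<bar>Arg z\<bar> < a"
      using a_pos unfolding continuous_at_eps_delta by (metis Arg_1 dist_norm diff_zero real_norm_def)
    have "nbhd0 (V0 \<inter> {x. \<forall>i<k. dist (X i x) 1 < d})" if "k \<le> m" for k
      using that
    proof (induction k)
      case (Suc k)
      have "V0 \<inter> {x. \<forall>i<Suc k. dist (X i x) 1 < d} =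
          (V0 \<inter> {x. \<forall>i<k. dist (X i x) 1 < d}) \<inter> {x. dist (X k x) 1 < d}"
        by (auto simp: less_Suc_eq)
      then show ?case using Suc nbhd0_dual[OF X d(1), of k] by (simp add: nbhd0_Int)
    qed (simp add: V0)
    from this[OF order_refl] show "nbhd0 V"
      by (rule nbhd0_mono) (auto simp: V_def intro: less_imp_le d(2))
  next
    have minus: "X i (- x) = 1 / X i x" if "i < m" for i x
      using circle_hom_diff[OF Xh(1)[OF that], of 0 x] circle_hom_zero[OF Xh(1)[OF that]] by simp
    have Arg_minus: "Arg (X i (- x)) = - Arg (X i x)" if "i < m" "x \<in> V" for i x
      using that a(1) X1 by (auto simp: minus V_def intro!: Arg_inverse_small)
    show "- x \<in> V" if "x \<in> V" for x
    proof -
      have "\<forall>i<m. \<bar>Arg (X i (- x))\<bar> \<le> a" using that Arg_minus[OF _ that] by (simp add: V_def)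
      then show ?thesis using that V0(3) by (simp add: V_def)
    qed
    show "\<theta> (- x) = - \<theta> x" if "x \<in> V" for x
      using Arg_minus[OF _ that] by (simp add: \<theta>_def coord_vec_uminus cong: coord_vec_cong)
  next
    have "continuous_map (subtopology T V) euclidean (\<lambda>x. Arg (X i x) *\<^sub>R unit_vec i)" if i: "i < m" for i
    proof -
      have "continuous_map (subtopology T V) (top_of_set (cis ` {-a..a})) (X i)"
        using i Xh(2) X1 by (auto simp: continuous_map_in_subtopology V_def cis_image_iff[OF a(1)]
            intro!: continuous_map_from_subtopology)
      then have "continuous_map (subtopology T V) euclidean ((\<lambda>z. Arg z *\<^sub>R unit_vec i) \<circ> X i)"
      proof (rule continuous_map_compose)
        have "cis t \<notin> \<real>\<^sub>\<le>\<^sub>0" if "\<bar>t\<bar> \<le> 1" for t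
        proof -
          have "cos t > 0" using that pi_gt3 by (intro cos_gt_zero_pi) auto
          then show ?thesis by (auto simp: complex_nonpos_Reals_iff)
        qed
        then have "cis ` {-a..a} \<subseteq> - \<real>\<^sub>\<le>\<^sub>0" using a(1) by auto
        then have "continuous_on (cis ` {-a..a}) Arg" using continuous_on_Arg continuous_on_subset by blast
        then have "continuous_on (cis ` {-a..a}) (\<lambda>z. Arg z *\<^sub>R unit_vec i)"
          by (intro continuous_on_scaleR continuous_on_const)
        then show "continuous_map (top_of_set (cis ` {-a..a})) euclidean (\<lambda>z. Arg z *\<^sub>R unit_vec i)" by simp
      qed
      then show ?thesis by (simp add: o_def)
    qed
    then show "continuous_map (subtopology T V) euclidean \<theta>"
      unfolding \<theta>_def coord_vec_def by (intro continuous_map_sum) auto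
  next
    show "norm (\<theta> x) \<le> a" if "x \<in> V" for x
      using that a_pos by (simp add: \<theta>_def norm_coord_vec_le_iff V_def)
  next
    fix x y assume x: "x \<in> V" and y: "y \<in> V" and "norm (\<theta> x + \<theta> y) \<le> a"
    then have sum: "\<bar>Arg (X i x) + Arg (X i y)\<bar> \<le> a" if "i < m" for i
      using that a_pos by (simp add: \<theta>_def coord_vec_add norm_coord_vec_le_iff)
    have Arg_add: "Arg (X i (x + y)) = Arg (X i x) + Arg (X i y)" if i: "i < m" for i
    proof -
      have "X i (x + y) = X i x * X i y" using Xh(1)[OF i] by (simp add: circle_hom_def)
      then show ?thesis using Arg_mult_small[OF X1[OF i] X1[OF i]] sum[OF i] a(1) by simp
    qed
    have "x + y \<in> O0"
    proof (rule ccontr)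
      assume "x + y \<notin> O0"
      moreover have "x + y \<in> Q" unfolding Q_def using x y by (force simp: V_def)
      ultimately obtain p where p: "p \<in> F" "x + y \<in> W p" using F(3) by blast
      then obtain i where i: "i < m" "p = g i" using g by blast
      have "dist (X i (x + y)) 1 \<le> a"
        using dist_1_le_Arg[OF X1[OF i(1)]] sum[OF i(1)] by (metis Arg_add[OF i(1)] order_trans)
      also have "\<dots> \<le> snd p" using a(2) p by blast
      finally show False using p(2) i by (simp add: W_def X_def)
    qed
    then show "x + y \<in> V \<and> \<theta> (x + y) = \<theta> x + \<theta> y"
      using O0(3) sum Arg_add by (auto simp: V_def \<theta>_def coord_vec_add cong: coord_vec_cong)
  next
    show "\<exists>C. \<forall>x\<in>V. \<bar>f (\<theta> x)\<bar> \<le> C * norm (\<theta> x)" if "linear f" for f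
      unfolding \<theta>_def using coord_vec_linear_bound[OF that] by blast
    show "\<theta> ` V \<subseteq> span (unit_vec ` {..<m})"
      unfolding \<theta>_def coord_vec_def by (intro image_subsetI span_sum span_scale span_base) auto
  qed (use a_pos in auto)
  then show ?thesis using that by blast
qed

lemma openin_tau_K_imp_openin:
  assumes "openin (tau_K T) U" shows "openin T U"
proof (rule openin_via_nbhd0)
  fix x assume "x \<in> U"
  then obtain K e where K: "K \<in> K_family T" "e > 0" "{y. \<forall>h\<in>K. dist (h y) (h x) < e} \<subseteq> U"
    using assms unfolding openin_tau_K by blast
  have Kh: "circle_hom h" if "h \<in> K" for h using K(1) that by (auto simp: K_family_iff dual_group_iff)
  have "dist (h (x + y)) (h x) = dist (h y) 1" if "h \<in> K" for h y
    using circle_hom_dist[OF Kh[OF that], of "x + y" x] by simp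
  then have "{y. \<forall>h\<in>K. dist (h y) 1 < e} \<subseteq> {y. x + y \<in> U}" using K(3) by auto
  then show "nbhd0 {y. x + y \<in> U}" using nbhd0_mono K_family_equicontinuous[OF K(1,2)] by blast
qed

lemma topspace_tau_K: "topspace (tau_K T) = UNIV"
proof -
  have "{} \<in> K_family T" by (simp add: K_family_iff)
  then have "openin (tau_K T) UNIV" unfolding openin_tau_K by (auto intro: exI[of _ 1])
  then show ?thesis using openin_subset by blast
qed

text \<open>Some ball of uniform convergence sits in a \<open>T\<close>-compact set, which stays
  compact in the coarser topology \<open>tau_K T\<close>; translation does the rest.\<close>

lemma locally_compact_tau_K:
  assumes sep: "\<And>x. x \<noteq> 0 \<Longrightarrow> \<exists>h\<in>dual_group T. h x \<noteq> 1"
  shows "locally_compact_space (tau_K T)"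
  unfolding locally_compact_space_def
proof
  fix x
  obtain V \<theta> a E where "lc_chart T V (\<theta> :: 'a \<Rightarrow> (nat, real) bcontfun) a E" using chart_exists[OF sep] by blast
  then obtain W b L where "linear_chart T W \<theta> b E L" using lc_chart.linear_subchart by blast
  from linear_chart.compact_ball_exists[OF this] obtain K C
    where K: "K \<in> K_family T" and C: "compactin T C" "{x. \<forall>h\<in>K. dist (h x) 1 < 1/2} \<subseteq> C"
    by (elim bexE exE conjE)
  have Kh: "circle_hom h" if "h \<in> K" for h using K(1) that by (auto simp: K_family_iff dual_group_iff)
  \<comment> \<open>The margin \<open>d\<close>, common to all \<open>h\<close>, makes this set open
    by the triangle inequality.\<close>
  define U where "U = {y. \<exists>d<1/2. \<forall>h\<in>K. dist (h y) (h x) \<le> d}"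
  have "openin (tau_K T) U"
    unfolding openin_tau_K
  proof
    fix y assume "y \<in> U"
    then obtain d where d: "d < 1/2" "\<And>h. h \<in> K \<Longrightarrow> dist (h y) (h x) \<le> d" by (auto simp: U_def)
    define e where "e = (1/2 - d) / 2"
    have "z \<in> U" if z: "\<forall>h\<in>K. dist (h z) (h y) < e" for z
    proof -
      have "dist (h z) (h x) \<le> e + d" if "h \<in> K" for h
        using dist_triangle[of "h z" "h x" "h y"] z that d(2)[OF that] by fastforce
      moreover have "e + d < 1/2" using d(1) by (simp add: e_def field_simps)
      ultimately show ?thesis unfolding U_def by blast
    qed
    moreover have "e > 0" using d(1) by (simp add: e_def)
    ultimately show "\<exists>K\<in>K_family T. \<exists>e>0. {z. \<forall>h\<in>K. dist (h z) (h y) < e} \<subseteq> U" using K by blast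
  qed
  moreover have "compactin (tau_K T) ((\<lambda>c. c + x) ` C)"
  proof (rule image_compactin[OF C(1)])
    have "continuous_map T (tau_K T) id"
      using openin_tau_K_imp_openin by (simp add: continuous_map_def topspace_tau_K)
    from continuous_map_compose[OF continuous_map_translate this]
    show "continuous_map T (tau_K T) (\<lambda>c. c + x)" by (simp add: o_def)
  qed
  moreover have "x \<in> U" unfolding U_def by (auto intro: exI[of _ 0])
  moreover have "U \<subseteq> (\<lambda>c. c + x) ` C"
  proof
    fix y assume "y \<in> U"
    then have "dist (h (y - x)) 1 < 1/2" if "h \<in> K" for h
      using that circle_hom_dist[OF Kh[OF that], of y x] by (force simp: U_def)
    then have "y - x \<in> C" using C(2) by blast
    then show "y \<in> (\<lambda>c. c + x) ` C" by (intro image_eqI[of _ _ "y - x"]) auto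
  qed
  ultimately show "\<exists>U K. openin (tau_K T) U \<and> compactin (tau_K T) K \<and> x \<in> U \<and> U \<subseteq> K" by blast
qed

end

section \<open>The Bohr topology and its characters\<close>

lemma openin_bohr_imp_openin:
  assumes top: "topspace T = UNIV" and U: "openin (bohr_topology T) U"
  shows "openin T U"
proof -
  have "generate_topology_on {h -` V | h V. h \<in> dual_group T \<and> open V} U"
    using U by (simp add: bohr_topology_def openin_topology_generated_by_iff)
  then show ?thesis
  proof induction
    case (Basis U)
    then obtain h V where U: "U = h -` V" "h \<in> dual_group T" "open V" by blast
    have "openin T {x \<in> topspace T. h x \<in> V}"
      using U by (intro openin_continuous_map_preimage[of T euclidean]) (auto simp: dual_group_iff[OF top])
    then show ?case by (simp add: U(1) top vimage_def)
  qed auto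
qed

lemma topspace_bohr: "topspace (bohr_topology T) = UNIV" if "topspace T = UNIV"
proof -
  have "(\<lambda>_. 1) \<in> dual_group T" by (simp add: dual_group_iff[OF that] circle_hom_def)
  then have "openin (bohr_topology T) ((\<lambda>_. 1 :: complex) -` UNIV)"
    unfolding bohr_topology_def by (intro topology_generated_by_Basis) blast
  then show ?thesis using openin_subset by fastforce
qed

text \<open>Characters of \<open>T\<close> are Bohr continuous by construction, and the Bohr
  topology is coarser than \<open>T\<close>. Thus equal Bohr topologies force equal duals.\<close>

lemma dual_group_bohr:
  assumes "topspace T = UNIV"
  shows "dual_group (bohr_topology T) = dual_group T"
proof (intro set_eqI iffI)
  fix h assume "h \<in> dual_group (bohr_topology T)"
  then have "circle_hom h" "continuous_map (bohr_topology T) euclidean h"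
    by (simp_all add: dual_group_iff topspace_bohr assms)
  then show "h \<in> dual_group T"
    using openin_bohr_imp_openin[OF assms] by (simp add: dual_group_iff assms continuous_map_def topspace_bohr)
next
  fix h assume h: "h \<in> dual_group T"
  have "openin (bohr_topology T) (h -` V)" if "open V" for V
    unfolding bohr_topology_def using h that by (intro topology_generated_by_Basis) blast
  then show "h \<in> dual_group (bohr_topology T)"
    using h by (simp add: dual_group_iff assms topspace_bohr continuous_map_def vimage_def)
qed

text \<open>If no character tells \<open>x\<close> from 0, then no open set does, by induction on
  its generation from preimages.\<close>

lemma Hausdorff_bohr_separates:
  assumes top: "topspace T = UNIV" and H: "Hausdorff_space (bohr_topology T)" and x: "x \<noteq> 0"
  shows "\<exists>h\<in>dual_group T. h x \<noteq> 1"
proof (rule ccontr)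
  assume "\<not> ?thesis"
  then have eq: "h x = h 0" if "h \<in> dual_group T" for h
    using that circle_hom_zero[of h] by (auto simp: dual_group_iff[OF top])
  have same: "x \<in> U \<longleftrightarrow> 0 \<in> U" if "openin (bohr_topology T) U" for U
  proof -
    have "generate_topology_on {h -` V | h V. h \<in> dual_group T \<and> open V} U"
      using that by (simp add: bohr_topology_def openin_topology_generated_by_iff)
    then show ?thesis
    proof induction
      case (Basis U)
      then obtain h V where U: "U = h -` V" "h \<in> dual_group T" by blast
      show ?case by (simp add: U(1) eq[OF U(2)])
    qed blast+
  qed
  obtain U V where "openin (bohr_topology T) U" "openin (bohr_topology T) V" "x \<in> U" "0 \<in> V" "disjnt U V"
    using H x unfolding Hausdorff_space_def topspace_bohr[OF top] by (metis UNIV_I)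
  then show False using same by (auto simp: disjnt_iff)
qed

theorem proposition4p9:
  fixes \<tau> :: "'a::ab_group_add topology"
  assumes "group_topology \<tau>"
    and "dual_group (tau_K \<tau>) = dual_group \<tau>"
    and "\<not> locally_compact_space (tau_K \<tau>)"
  shows "\<not> class_B (bohr_topology \<tau>)"
proof
  assume "class_B (bohr_topology \<tau>)"
  then obtain \<mu> where H: "Hausdorff_space (bohr_topology \<mu>)" and \<mu>: "group_topology \<mu>" "locally_compact_space \<mu>"
      and eq: "bohr_topology \<mu> = bohr_topology \<tau>"
    unfolding class_B_def by metis
  have top: "topspace \<mu> = UNIV" "topspace \<tau> = UNIV" using \<mu>(1) assms(1) by (simp_all add: group_topology_def)
  \<comment> \<open>The Bohr topology is coarser than \<open>\<mu>\<close>, so \<open>\<mu>\<close>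
    inherits its separation.\<close>
  have "Hausdorff_space \<mu>"
    using H openin_bohr_imp_openin[OF top(1)] unfolding Hausdorff_space_def topspace_bohr[OF top(1)] top(1)
    by meson
  then interpret lc_group \<mu> using \<mu> by unfold_locales
  have "dual_group \<mu> = dual_group \<tau>" using dual_group_bohr top eq by metis
  \<comment> \<open>\<open>tau_K\<close> sees the topology only through the dual, so
    \<open>\<mu>\<close> may replace \<open>\<tau>\<close>.\<close>
  then have "tau_K \<mu> = tau_K \<tau>" by (simp add: tau_K_def K_family_def pointwise_topology_def)
  moreover have "locally_compact_space (tau_K \<mu>)"
    using locally_compact_tau_K Hausdorff_bohr_separates[OF top(1) H] by blast
  ultimately show False using assms(3) by simp
qed

end
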